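(* Let $0<p\le 1<q<\infty$ and $\alpha>-1$, let $q'=\frac{q}{q-1}$, and let $\mu$ be a positive Borel measure on $[0,1)$ which is a $\frac{2}{p}$-Carleson measure. Then the following hold. (a) If $\alpha+1-\frac{2}{q}>0$, then $\mathcal{H}_{\mu}^{\alpha}:A^{p}\to A^{q}$ is bounded if and only if $\mu$ is a $\left(\frac{2}{p}+\frac{2}{q'}+\alpha-1\right)$-Carleson measure. (b) If $\alpha+1-\frac{2}{q}<0$, then $\mathcal{H}_{\mu}^{\alpha}:A^{p}\to A^{q}$ is bounded. (c) If $\alpha+1-\frac{2}{q}=0$ and $\mu$ is a $\frac{1}{q}$-logarithmic $\frac{2}{p}$-Carleson measure, then $\mathcal{H}_{\mu}^{\alpha}:A^{p}\to A^{q}$ is bounded.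
   Context: $\mathbb{D}$ is the open unit disk in $\mathbb{C}$, $H(\mathbb{D})$ is the space of analytic functions on $\mathbb{D}$, and $dA=\frac{dx\,dy}{\pi}$. For $0<p<\infty$, the Bergman space $A^{p}$ consists of all $f\in H(\mathbb{D})$ with $\|f\|_{A^{p}}=\left(\int_{\mathbb{D}}|f(z)|^{p}dA(z)\right)^{1/p}<\infty$. For $s>0$ and $\beta\ge 0$, a positive Borel measure $\mu$ on $[0,1)$ is a $\beta$-logarithmic $s$-Carleson measure if there is $M>0$ with $\mu([t,1))\left(\log\frac{e}{1-t}\right)^{\beta}\le M(1-t)^{s}$ for all $0\le t<1$. When $\beta=0$ it is called an $s$-Carleson measure. Put $\mu_{n}=\int_{[0,1)}t^{n}d\mu(t)$ and $\mu_{n,k}=\mu_{n+k}$ for $n,k\ge 0$. For $\alpha>-1$ and $f(z)=\sum_{k=0}^{\infty}a_{k}z^{k}\in H(\mathbb{D})$, define $$\mathcal{H}_{\mu}^{\alpha}(f)(z)=\sum_{n=0}^{\infty}\frac{\Gamma(n+1+\alpha)}{\Gamma(n+1)\Gamma(\alpha+1)}\left(\sum_{k=0}^{\infty}\mu_{n,k}a_{k}\right)z^{n},\quad z\in\mathbb{D},$$ whenever the inner series converge and the power series converges in $\mathbb{D}$. That $\mathcal{H}_{\mu}^{\alpha}:X\to Y$ is bounded means that $\mathcal{H}_\mu^\alpha(f)$ is well defined in this sense and belongs to $Y$ for every $f\in X$, and there is $C>0$ with $\|\mathcal{H}_{\mu}^{\alpha}(f)\|_{Y}\le C\|f\|_{X}$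 for all $f\in X$. *)

theory Defs
  imports "HOL-Complex_Analysis.Complex_Analysis"
begin

definition disc_area :: "complex measure" where
  "disc_area = scale_measure (ennreal (1 / pi)) (restrict_space lborel (ball 0 1))"

(* Only the values on the open unit disc matter for membership and for the norm. *)

definition bergman_space :: "real \<Rightarrow> (complex \<Rightarrow> complex) set" where
  "bergman_space p =
     {f. f holomorphic_on ball 0 1 \<and> integrable disc_area (\<lambda>z. norm (f z) powr p)}"

definition bergman_norm :: "real \<Rightarrow> (complex \<Rightarrow> complex) \<Rightarrow> real" where
  "bergman_norm p f = (LINT z|disc_area. norm (f z) powr p) powr (1 / p)"

definition borel_measure_on_unit :: "real measure \<Rightarrow> bool" where
  "borel_measure_on_unit \<mu> \<longleftrightarrow> sets \<mu> = sets (restrict_space borel {0..<1})"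

(* Stated with emeasure, so that t = 0 forces the measure to be finite. *)

definition log_carleson :: "real \<Rightarrow> real \<Rightarrow> real measure \<Rightarrow> bool" where
  "log_carleson \<beta> s \<mu> \<longleftrightarrow>
     (\<exists>M>0. \<forall>t\<in>{0..<1}.
        emeasure \<mu> {t..<1} * ennreal (ln (exp 1 / (1 - t)) powr \<beta>) \<le> ennreal (M * (1 - t) powr s))"

definition carleson :: "real \<Rightarrow> real measure \<Rightarrow> bool" where
  "carleson s \<mu> \<longleftrightarrow> log_carleson 0 s \<mu>"

definition moment :: "real measure \<Rightarrow> nat \<Rightarrow> real" where
  "moment \<mu> n = (LINT t|\<mu>. t ^ n)"

definition hankel_entry :: "real measure \<Rightarrow> nat \<Rightarrow> nat \<Rightarrow> real" where
  "hankel_entry \<mu> n k = moment \<mu> (n + k)"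

definition taylor_coeff :: "(complex \<Rightarrow> complex) \<Rightarrow> nat \<Rightarrow> complex" where
  "taylor_coeff f k = fps_nth (fps_expansion f 0) k"

definition hilbert_coeff :: "real measure \<Rightarrow> real \<Rightarrow> (complex \<Rightarrow> complex) \<Rightarrow> nat \<Rightarrow> complex" where
  "hilbert_coeff \<mu> \<alpha> f n =
     of_real (Gamma (real n + 1 + \<alpha>) / (Gamma (real n + 1) * Gamma (\<alpha> + 1))) *
     (\<Sum>k. of_real (hankel_entry \<mu> n k) * taylor_coeff f k)"

definition hilbert_op :: "real measure \<Rightarrow> real \<Rightarrow> (complex \<Rightarrow> complex) \<Rightarrow> complex \<Rightarrow> complex" where
  "hilbert_op \<mu> \<alpha> f z = (\<Sum>n. hilbert_coeff \<mu> \<alpha> f n * z ^ n)"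

definition hilbert_op_defined :: "real measure \<Rightarrow> real \<Rightarrow> (complex \<Rightarrow> complex) \<Rightarrow> bool" where
  "hilbert_op_defined \<mu> \<alpha> f \<longleftrightarrow>
     (\<forall>n. summable (\<lambda>k. of_real (hankel_entry \<mu> n k) * taylor_coeff f k)) \<and>
     (\<forall>z\<in>ball 0 1. summable (\<lambda>n. hilbert_coeff \<mu> \<alpha> f n * z ^ n))"

definition hilbert_op_bounded :: "real measure \<Rightarrow> real \<Rightarrow> real \<Rightarrow> real \<Rightarrow> bool" where
  "hilbert_op_bounded \<mu> \<alpha> p q \<longleftrightarrow>
     (\<forall>f\<in>bergman_space p. hilbert_op_defined \<mu> \<alpha> f \<and> hilbert_op \<mu> \<alpha> f \<in> bergman_space q) \<and>
     (\<exists>C>0. \<forall>f\<in>bergman_space p.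
        bergman_norm q (hilbert_op \<mu> \<alpha> f) \<le> C * bergman_norm p f)"

end

theory Submission
  imports Defs "HOL-Real_Asymp.Real_Asymp"
begin

text \<open>
  Summing the series gives, for \<open>f\<close> in \<open>A\<^sup>p\<close>, the integral representation
  \<open>H f(z) = \<integral> f(t) (1 - t z) powr (-(\<alpha> + 1)) d\<mu>(t)\<close>. The \<open>A\<^sup>q\<close> norm of the kernel
  \<open>z \<mapsto> (1 - t z) powr (-(\<alpha> + 1))\<close> is, up to constants, bounded by a weight \<open>W(t)\<close>: with
  \<open>\<delta> = \<alpha> + 1 - 2/q\<close> it is \<open>(1 - t) powr (-\<delta>)\<close> when \<open>\<delta> > 0\<close>, constant when \<open>\<delta> < 0\<close>, and
  \<open>(log (e/(1 - t))) powr (1/q)\<close> when \<open>\<delta> = 0\<close>. In all three cases the assumption on \<open>\<mu>\<close> reads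
  \<open>\<mu>[t, 1) W(t) \<le> M (1 - t) powr (2/p)\<close>, so one argument (\<open>hilbert_op_bounded_of_weight\<close>) covers them.
  By Minkowski's integral inequality \<open>\<parallel>H f\<parallel>\<^sub>q\<close> is at most a multiple of \<open>\<integral> |f(t)| W(t) d\<mu>(t)\<close>, and
  it remains to bound this by \<open>\<parallel>f\<parallel>\<^sub>p\<close>. Because \<open>W\<close> grows at most by a fixed factor when the distance
  to 1 is halved, the tail condition passes to \<open>d\<nu> = W d\<mu>\<close> (\<open>tail_weighted_le\<close>), so \<open>\<nu>\<close> is a
  \<open>2/p\<close>-Carleson measure and its moments are \<open>O(k powr (-2/p))\<close>.

  The embedding \<open>\<integral> |f| d\<nu> \<le> C \<parallel>f\<parallel>\<^sub>p\<close> is obtained from Taylor coefficients: it follows from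
  \<open>\<Sum> (k + 1) powr (-2/p) |a\<^sub>k| \<le> C \<parallel>f\<parallel>\<^sub>p\<close> (\<open>bergman_coefficients_summable\<close>), which also gives the
  absolute convergence of the inner series of the operator. To prove it, bound \<open>|a\<^sub>k|\<close> by a multiple of the average
  of \<open>|f|\<close> over an annulus at distance about \<open>1/k\<close> from the circle; summing over \<open>k\<close>, these annuli add
  up to the weight \<open>(1 - |w|) powr (2/p - 2)\<close>. The resulting weighted \<open>L\<^sup>1\<close> norm is controlled by
  writing \<open>|f| = |f| powr p * |f| powr (1 - p)\<close> and using the growth estimate
  \<open>|f(z)| \<le> C \<parallel>f\<parallel>\<^sub>p (1 - |z|) powr (-2/p)\<close>; here \<open>p \<le> 1\<close> enters.

  For the converse in the first case, test the operator on \<open>f(z) = (1 - a z) powr (-n)\<close> with \<open>n p > 2\<close>.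
  At the point \<open>a\<close> all factors of the integral are positive, so \<open>H f(a)\<close> is at least
  \<open>(2 (1 - a)) powr (-(n + \<alpha> + 1)) \<mu>[a, 1)\<close>, while the growth estimate in \<open>A\<^sup>q\<close> and boundedness give an
  upper bound. Comparing the two bounds yields the Carleson condition.
\<close>

section \<open>Taylor coefficients and rotation-invariant area\<close>

lemma nn_integral_lborel_translate:
  fixes g :: "complex \<Rightarrow> ennreal"
  assumes [measurable]: "g \<in> borel_measurable borel"
  shows "(\<integral>\<^sup>+x. g (c + x) \<partial>lborel) = (\<integral>\<^sup>+x. g x \<partial>lborel)"
proof -
  have "(\<integral>\<^sup>+x. g x \<partial>lborel) = (\<integral>\<^sup>+x. g x \<partial>distr lborel borel ((+) c))"
    by (simp only: lborel_distr_plus)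
  also have "\<dots> = (\<integral>\<^sup>+x. g (c + x) \<partial>lborel)"
    by (subst nn_integral_distr) auto
  finally show ?thesis ..
qed

text \<open>
  The rotated measure is again invariant under translations, and two translation-invariant measures that
  agree on one ball are equal. Concretely, the integral of \<open>B(x) g(u y + x)\<close> over the plane in both variables,
  with \<open>B\<close> the indicator of the unit ball, is evaluated in two ways by Tonelli's theorem; each way produces
  the area of a unit ball as a factor, and this factor cancels.
\<close>

lemma nn_integral_lborel_rotate:
  fixes u :: complex and g :: "complex \<Rightarrow> ennreal"
  assumes u: "norm u = 1" and [measurable]: "g \<in> borel_measurable borel"
  shows "(\<integral>\<^sup>+y. g (u * y) \<partial>lborel) = (\<integral>\<^sup>+y. g y \<partial>lborel)"
proof -
  define B :: "complex \<Rightarrow> ennreal" where "B = indicator (ball 0 1)"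
  have [measurable]: "B \<in> borel_measurable borel"
    unfolding B_def by (intro borel_measurable_indicator) simp
  define c where "c = emeasure lborel (ball (0::complex) 1)"
  have u0: "u \<noteq> 0" using u by auto
  have "c = ennreal pi" by (simp add: c_def emeasure_ball eval_unit_ball_vol)
  then have c: "c \<noteq> 0" "c \<noteq> top" using pi_gt_zero by (simp_all add: ennreal_eq_0_iff not_le)
  have ball: "(\<integral>\<^sup>+y. B (x - u * y) \<partial>lborel) = c" for x
  proof -
    have "B (x - u * y) = indicator (ball (x / u) 1) y" for y
    proof -
      have "x - u * y = u * (x / u - y)" using u0 by (simp add: field_simps)
      then have "norm (x - u * y) = norm (x / u - y)" by (simp only: norm_mult u mult_1)
      then show ?thesis by (auto simp: B_def indicator_def dist_norm norm_minus_commute)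
    qed
    then show ?thesis unfolding c_def by (simp add: emeasure_ball)
  qed
  have "c * (\<integral>\<^sup>+y. g (u * y) \<partial>lborel) = (\<integral>\<^sup>+x. B x * (\<integral>\<^sup>+y. g (u * y) \<partial>lborel) \<partial>lborel)"
    by (subst nn_integral_multc) (measurable, simp add: c_def B_def)
  also have "\<dots> = (\<integral>\<^sup>+x. B x * (\<integral>\<^sup>+y. g (u * y + x) \<partial>lborel) \<partial>lborel)"
  proof (rule nn_integral_cong)
    fix x
    have "(\<integral>\<^sup>+y. g (u * (x / u + y)) \<partial>lborel) = (\<integral>\<^sup>+y. g (u * y) \<partial>lborel)"
      by (rule nn_integral_lborel_translate) measurable
    moreover have "u * (x / u + y) = u * y + x" for y using u0 by (simp add: field_simps)
    ultimately show "B x * (\<integral>\<^sup>+y. g (u * y) \<partial>lborel) = B x * (\<integral>\<^sup>+y. g (u * y + x) \<partial>lborel)"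
      by simp
  qed
  also have "\<dots> = (\<integral>\<^sup>+x. (\<integral>\<^sup>+y. B x * g (u * y + x) \<partial>lborel) \<partial>lborel)"
    by (subst nn_integral_cmult) auto
  also have "\<dots> = (\<integral>\<^sup>+y. (\<integral>\<^sup>+x. B x * g (u * y + x) \<partial>lborel) \<partial>lborel)"
    by (rule lborel_pair.Fubini') measurable
  also have "\<dots> = (\<integral>\<^sup>+y. (\<integral>\<^sup>+x. B (x - u * y) * g x \<partial>lborel) \<partial>lborel)"
  proof (rule nn_integral_cong)
    fix y
    have "(\<integral>\<^sup>+x. B ((- u * y + x)) * g (u * y + (- u * y + x)) \<partial>lborel) = (\<integral>\<^sup>+x. B x * g (u * y + x) \<partial>lborel)"
      by (rule nn_integral_lborel_translate) measurable
    then show "(\<integral>\<^sup>+x. B x * g (u * y + x) \<partial>lborel) = (\<integral>\<^sup>+x. B (x - u * y) * g x \<partial>lborel)"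
      by simp
  qed
  also have "\<dots> = (\<integral>\<^sup>+x. (\<integral>\<^sup>+y. B (x - u * y) * g x \<partial>lborel) \<partial>lborel)"
    by (rule lborel_pair.Fubini'[symmetric]) measurable
  also have "\<dots> = (\<integral>\<^sup>+x. c * g x \<partial>lborel)"
    by (subst nn_integral_multc) (auto simp: ball)
  also have "\<dots> = c * (\<integral>\<^sup>+x. g x \<partial>lborel)"
    by (rule nn_integral_cmult) auto
  finally show ?thesis
    using c by (simp add: ennreal_mult_cancel_left)
qed

lemma lborel_distr_rotate:
  fixes u :: complex
  assumes "norm u = 1"
  shows "distr lborel borel ((*) u) = lborel"
proof (rule measure_eqI)
  fix A assume "A \<in> sets (distr lborel borel ((*) u))"
  then have [measurable]: "A \<in> sets borel" by simp
  have "emeasure (distr lborel borel ((*) u)) A = (\<integral>\<^sup>+x. indicator A x \<partial>distr lborel borel ((*) u))"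
    by simp
  also have "\<dots> = (\<integral>\<^sup>+x. indicator A (u * x) \<partial>lborel)"
    by (subst nn_integral_distr) auto
  also have "\<dots> = (\<integral>\<^sup>+x. indicator A x \<partial>lborel)"
    using assms by (rule nn_integral_lborel_rotate) measurable
  finally show "emeasure (distr lborel borel ((*) u)) A = emeasure lborel A" by simp
qed simp

abbreviation annulus :: "real \<Rightarrow> real \<Rightarrow> complex set" where
  "annulus r1 r2 \<equiv> cball 0 r2 - ball 0 r1"

lemma compact_annulus: "compact (annulus r1 r2)"
  by (intro compact_diff) auto

lemma measure_annulus:
  assumes "0 \<le> r1" "r1 \<le> r2"
  shows "measure lborel (annulus r1 r2) = pi * (r2\<^sup>2 - r1\<^sup>2)"
proof -
  have "measure lborel (annulus r1 r2)
      = measure lborel (cball 0 r2 :: complex set) - measure lborel (ball 0 r1 :: complex set)"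
    using assms by (intro measure_Diff) (auto simp: emeasure_cball)
  then show ?thesis
    using assms by (simp add: content_cball content_ball eval_unit_ball_vol algebra_simps)
qed

text \<open>
  One rotation suffices: a rotation by the angle \<open>\<pi>/(j - k)\<close> preserves the annulus and multiplies the
  integrand by -1.
\<close>

lemma annulus_monomials_orthogonal:
  fixes j k :: nat
  assumes "j \<noteq> k"
  shows "(LINT w|lborel. indicator (annulus r1 r2) w *\<^sub>R (w ^ j * cnj w ^ k)) = 0"
proof -
  let ?g = "\<lambda>w::complex. indicator (annulus r1 r2) w *\<^sub>R (w ^ j * cnj w ^ k)"
  have m: "?g \<in> borel_measurable borel"
    by (intro borel_measurable_scaleR borel_measurable_indicator) (auto intro!: borel_measurable_continuous_onI continuous_intros)
  define \<theta> where "\<theta> = pi / (real j - real k)"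
  define u where "u = cis \<theta>"
  have u: "norm u = 1" by (simp add: u_def)
  have "u ^ j * cnj u ^ k = cis (real j * \<theta> - real k * \<theta>)"
    unfolding u_def cis_cnj Complex.DeMoivre cis_mult by simp
  also have "real j * \<theta> - real k * \<theta> = pi"
    using assms by (simp add: \<theta>_def divide_simps) (simp add: algebra_simps)
  finally have uu: "u ^ j * cnj u ^ k = -1" by (simp add: cis_pi)
  have "integral\<^sup>L lborel ?g = integral\<^sup>L (distr lborel borel ((*) u)) ?g"
    by (simp only: lborel_distr_rotate[OF u])
  also have "\<dots> = (LINT w|lborel. ?g (u * w))"
    using m by (subst integral_distr) auto
  also have "(\<lambda>w. ?g (u * w)) = (\<lambda>w. (u ^ j * cnj u ^ k) * ?g w)"
    by (rule ext) (auto simp: indicator_def norm_mult u power_mult_distrib)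
  also have "(LINT w|lborel. \<dots> w) = - (LINT w|lborel. ?g w)"
    by (simp add: uu)
  finally show ?thesis by simp
qed

text \<open>
  Integrating the power series of \<open>f\<close> against \<open>cnj w ^ k\<close> term by term leaves only the term of index \<open>k\<close>.
\<close>

lemma annulus_coefficient:
  assumes f: "f holomorphic_on ball 0 R" and r: "0 \<le> r1" "r1 \<le> r2" "r2 < R"
  shows "taylor_coeff f k * (LINT w|lborel. indicator (annulus r1 r2) w *\<^sub>R (w ^ k * cnj w ^ k))
       = (LINT w|lborel. indicator (annulus r1 r2) w *\<^sub>R (f w * cnj w ^ k))"
proof -
  let ?A = "annulus r1 r2"
  define a where "a = taylor_coeff f"
  define h where "h j w = indicator ?A w *\<^sub>R (a j * w ^ j * cnj w ^ k)" for j :: nat and w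
  have sums: "(\<lambda>j. a j * w ^ j) sums f w" if "w \<in> ball 0 R" for w
    using holomorphic_power_series[OF f that] by (simp add: a_def taylor_coeff_def fps_expansion_def)
  have aR: "summable (\<lambda>j. norm (a j) * r2 ^ j)"
  proof -
    have "summable (\<lambda>j. norm (a j * of_real r2 ^ j))"
    proof (rule powser_insidea)
      show "summable (\<lambda>j. a j * of_real ((r2 + R) / 2) ^ j)"
        using r by (intro sums_summable[OF sums]) (auto simp del: of_real_add of_real_divide of_real_diff of_real_mult)
    qed (use r in \<open>auto simp del: of_real_add of_real_divide\<close>)
    then show ?thesis using r by (simp add: norm_mult norm_power)
  qed
  have int: "integrable lborel (h j)" for j
    unfolding h_def by (intro borel_integrable_compact compact_annulus) (auto intro!: continuous_intros)
  have bound: "norm (h j w) \<le> (norm (a j) * r2 ^ j * r2 ^ k) * indicator ?A w" for j w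
  proof (cases "w \<in> ?A")
    case True
    then have "norm w \<le> r2" by simp
    then have "norm (a j) * norm w ^ j * norm w ^ k \<le> norm (a j) * r2 ^ j * r2 ^ k"
      using r by (intro mult_mono power_mono) auto
    then show ?thesis using True by (simp add: h_def norm_mult norm_power)
  qed (simp add: h_def)
  have sm: "AE w in lborel. summable (\<lambda>j. norm (h j w))"
  proof (rule AE_I2)
    fix w
    show "summable (\<lambda>j. norm (h j w))"
    proof (rule summable_comparison_test')
      show "summable (\<lambda>j. (norm (a j) * r2 ^ j) * (r2 ^ k * indicator ?A w))"
        by (intro summable_mult2 aR)
      show "norm (norm (h j w)) \<le> (norm (a j) * r2 ^ j) * (r2 ^ k * indicator ?A w)" for j
        using bound[of j w] by (simp add: mult.assoc)
    qed
  qed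
  have si: "summable (\<lambda>j. LINT w|lborel. norm (h j w))"
  proof (rule summable_comparison_test_ev)
    have "(LINT w|lborel. norm (h j w)) \<le> (norm (a j) * r2 ^ j) * (r2 ^ k * measure lborel ?A)" for j
    proof -
      have "integrable lborel (indicator ?A :: complex \<Rightarrow> real)"
        using emeasure_bounded_finite[of ?A] by (auto simp: bounded_diff)
      then have "(LINT w|lborel. norm (h j w)) \<le> (LINT w|lborel. (norm (a j) * r2 ^ j * r2 ^ k) * indicator ?A w)"
        using bound by (intro integral_mono) (auto intro!: int)
      also have "\<dots> = (norm (a j) * r2 ^ j) * (r2 ^ k * measure lborel ?A)"
        by (simp add: mult_ac)
      finally show ?thesis .
    qed
    then show "\<forall>\<^sub>F j in sequentially. norm (LINT w|lborel. norm (h j w)) \<le> (norm (a j) * r2 ^ j) * (r2 ^ k * measure lborel ?A)"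
      by (auto intro!: always_eventually)
  qed (intro summable_mult2 aR)
  have "(LINT w|lborel. indicator ?A w *\<^sub>R (f w * cnj w ^ k)) = (LINT w|lborel. (\<Sum>j. h j w))"
  proof (rule Bochner_Integration.integral_cong[OF refl])
    fix w
    show "indicator ?A w *\<^sub>R (f w * cnj w ^ k) = (\<Sum>j. h j w)"
    proof (cases "w \<in> ?A")
      case True
      then have "(\<lambda>j. a j * w ^ j * cnj w ^ k) sums (f w * cnj w ^ k)"
        using r by (intro sums_mult2 sums) auto
      then show ?thesis using True by (simp add: h_def sums_iff)
    qed (simp add: h_def)
  qed
  also have "\<dots> = (\<Sum>j. integral\<^sup>L lborel (h j))"
    by (intro integral_suminf int sm si)
  also have "\<dots> = integral\<^sup>L lborel (h k)"
  proof -
    have "integral\<^sup>L lborel (h j) = 0" if "j \<noteq> k" for j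
    proof -
      have "h j = (\<lambda>w. a j * (indicator ?A w *\<^sub>R (w ^ j * cnj w ^ k)))"
        by (auto simp: h_def fun_eq_iff)
      then have "integral\<^sup>L lborel (h j)
          = a j * (LINT w|lborel. indicator ?A w *\<^sub>R (w ^ j * cnj w ^ k))"
        by (simp only: integral_mult_right_zero)
      then show ?thesis by (simp only: annulus_monomials_orthogonal[OF that] mult_zero_right)
    qed
    then show ?thesis using suminf_finite[of "{k}" "\<lambda>j. integral\<^sup>L lborel (h j)"] by simp
  qed
  also have "h k = (\<lambda>w. a k * (indicator ?A w *\<^sub>R (w ^ k * cnj w ^ k)))"
    by (auto simp: h_def fun_eq_iff)
  also have "integral\<^sup>L lborel \<dots>
      = a k * (LINT w|lborel. indicator ?A w *\<^sub>R (w ^ k * cnj w ^ k))"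
    by (simp only: integral_mult_right_zero)
  finally show ?thesis by (simp only: a_def)
qed

text \<open>
  An area version of Cauchy's estimate; for \<open>k = 0\<close> and \<open>r1 = 0\<close> it is the mean value inequality.
\<close>

lemma taylor_coeff_le_annulus_integral:
  assumes f: "f holomorphic_on ball 0 R" and r: "0 \<le> r1" "r1 \<le> r2" "r2 < R"
  shows "norm (taylor_coeff f k) * (r1 ^ (2 * k) * (pi * (r2\<^sup>2 - r1\<^sup>2)))
       \<le> r2 ^ k * (LINT w|lborel. indicator (annulus r1 r2) w * norm (f w))"
proof -
  let ?A = "annulus r1 r2"
  have ww: "w ^ k * cnj w ^ k = of_real (norm w ^ (2 * k))" for w :: complex
  proof -
    have e: "w * cnj w = of_real ((norm w)\<^sup>2)" by (rule complex_norm_square[symmetric])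
    have "w ^ k * cnj w ^ k = (w * cnj w) ^ k" by (simp add: power_mult_distrib)
    also have "\<dots> = of_real (((norm w)\<^sup>2) ^ k)" by (simp only: e of_real_power)
    also have "((norm w)\<^sup>2) ^ k = norm w ^ (2 * k)" by (rule power_mult[symmetric])
    finally show ?thesis .
  qed
  have cf: "continuous_on ?A f"
    using r by (intro holomorphic_on_imp_continuous_on holomorphic_on_subset[OF f]) auto
  have i1: "integrable lborel (\<lambda>w. indicator ?A w *\<^sub>R norm w ^ (2 * k))"
    by (intro borel_integrable_compact compact_annulus) (auto intro!: continuous_intros)
  have i2: "integrable lborel (\<lambda>w. indicator ?A w *\<^sub>R norm (f w))"
    by (intro borel_integrable_compact compact_annulus) (auto intro!: continuous_intros cf)
  have i3: "integrable lborel (\<lambda>w. indicator ?A w *\<^sub>R (f w * cnj w ^ k))"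
    by (intro borel_integrable_compact compact_annulus) (auto intro!: continuous_intros cf)
  have fin: "integrable lborel (indicator ?A :: complex \<Rightarrow> real)"
    using emeasure_bounded_finite[of ?A] by (auto simp: bounded_diff)
  have "r1 ^ (2 * k) * (pi * (r2\<^sup>2 - r1\<^sup>2)) = (LINT w|lborel. r1 ^ (2 * k) * indicator ?A w)"
    using r by (simp add: measure_annulus)
  also have "\<dots> \<le> (LINT w|lborel. indicator ?A w *\<^sub>R norm w ^ (2 * k))"
  proof (intro integral_mono integrable_mult_right fin i1)
    show "r1 ^ (2 * k) * indicator ?A w \<le> indicator ?A w *\<^sub>R norm w ^ (2 * k)" for w :: complex
      using r by (auto simp: indicator_def intro!: power_mono)
  qed
  finally have "norm (taylor_coeff f k) * (r1 ^ (2 * k) * (pi * (r2\<^sup>2 - r1\<^sup>2)))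
      \<le> norm (taylor_coeff f k) * (LINT w|lborel. indicator ?A w *\<^sub>R norm w ^ (2 * k))"
    by (intro mult_left_mono) auto
  also have "\<dots> = norm (taylor_coeff f k * of_real (LINT w|lborel. indicator ?A w *\<^sub>R norm w ^ (2 * k)))"
    by (auto simp: norm_mult intro!: integral_nonneg)
  also have "of_real (LINT w|lborel. indicator ?A w *\<^sub>R norm w ^ (2 * k))
      = (LINT w|lborel. indicator ?A w *\<^sub>R (w ^ k * cnj w ^ k))"
    by (subst integral_complex_of_real[symmetric]) (simp add: ww scaleR_conv_of_real)
  also have "taylor_coeff f k * \<dots> = (LINT w|lborel. indicator ?A w *\<^sub>R (f w * cnj w ^ k))"
    by (rule annulus_coefficient[OF f r])
  also have "norm \<dots> \<le> (LINT w|lborel. norm (indicator ?A w *\<^sub>R (f w * cnj w ^ k)))"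
    by (rule integral_norm_bound)
  also have "\<dots> \<le> (LINT w|lborel. r2 ^ k * (indicator ?A w *\<^sub>R norm (f w)))"
  proof (intro integral_mono integrable_norm i3 integrable_mult_right i2)
    show "norm (indicator ?A w *\<^sub>R (f w * cnj w ^ k)) \<le> r2 ^ k * (indicator ?A w *\<^sub>R norm (f w))" for w
    proof (cases "w \<in> ?A")
      case True
      then have "norm w ^ k \<le> r2 ^ k" by (intro power_mono) auto
      then show ?thesis
        using True mult_right_mono[of "norm w ^ k" "r2 ^ k" "norm (f w)"]
        by (simp add: norm_mult norm_power mult.commute)
    qed simp
  qed
  finally show ?thesis by simp
qed

lemma norm_le_disc_average:
  assumes f: "f holomorphic_on ball z R" and r: "0 < r" "r < R"
  shows "norm (f z) * (pi * r\<^sup>2) \<le> (LINT w|lborel. indicator (cball z r) w * norm (f w))"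
proof -
  let ?g = "\<lambda>w. f (z + w)"
  have g: "?g holomorphic_on ball 0 R"
    using holomorphic_on_compose_gen[of "\<lambda>w. z + w" "ball 0 R" f "ball z R"] f
    by (auto simp: o_def dist_norm holomorphic_on_add)
  have "norm (f z) * (pi * r\<^sup>2) \<le> (LINT w|lborel. indicator (cball 0 r) w * norm (f (z + w)))"
    using taylor_coeff_le_annulus_integral[OF g, of 0 r 0] r
    by (simp add: taylor_coeff_def fps_expansion_def)
  also have "\<dots> = (LINT w|lborel. indicator (cball z r) (z + w) * norm (f (z + w)))"
    by (intro Bochner_Integration.integral_cong) (auto simp: indicator_def dist_norm norm_minus_commute)
  also have "\<dots> = (LINT w|distr lborel borel ((+) z). indicator (cball z r) w * norm (f w))"
  proof (rule integral_distr[symmetric])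
    have "continuous_on (cball z r) f"
      using r by (intro holomorphic_on_imp_continuous_on holomorphic_on_subset[OF f]) auto
    then have "integrable lborel (\<lambda>w. indicator (cball z r) w *\<^sub>R norm (f w))"
      by (intro borel_integrable_compact) (auto intro!: continuous_intros)
    then show "(\<lambda>w. indicator (cball z r) w * norm (f w)) \<in> borel_measurable borel"
      by (auto dest: borel_measurable_integrable)
  qed auto
  finally show ?thesis by (simp only: lborel_distr_plus)
qed

section \<open>Bergman spaces with exponent at most one\<close>

lemma space_disc_area [simp]: "space disc_area = ball 0 1"
  by (simp add: disc_area_def space_scale_measure space_restrict_space)

lemma sets_disc_area: "sets disc_area = sets (restrict_space borel (ball 0 1))"
  by (simp add: disc_area_def sets_restrict_space)

lemma disc_area_eq_density:
  "disc_area = density (restrict_space lborel (ball 0 1)) (\<lambda>_. ennreal (1 / pi))"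
  by (rule measure_eqI) (auto simp: disc_area_def emeasure_density nn_integral_cmult_indicator)

lemma borel_measurable_disc_area:
  assumes "continuous_on (ball 0 1) f"
  shows "f \<in> borel_measurable disc_area"
  using borel_measurable_continuous_on_restrict[OF assms]
  by (simp add: measurable_cong_sets[OF sets_disc_area refl])

lemma integral_disc_area:
  fixes h :: "complex \<Rightarrow> real"
  assumes "h \<in> borel_measurable disc_area"
  shows "(LINT w|disc_area. h w) = (LINT w|lborel. indicator (ball 0 1) w * h w) / pi"
proof -
  have h: "h \<in> borel_measurable (restrict_space lborel (ball 0 1))"
    using assms by (simp add: disc_area_def)
  then show ?thesis
    unfolding disc_area_eq_density
    by (subst integral_real_density) (auto simp: integral_restrict_space)
qed

lemma emeasure_disc_area_UNIV: "emeasure disc_area (ball 0 1) = 1"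
  by (simp add: disc_area_def emeasure_restrict_space emeasure_ball eval_unit_ball_vol
      flip: ennreal_mult' ennreal_1)

lemma finite_measure_disc_area: "finite_measure disc_area"
  by (rule finite_measureI) (simp add: emeasure_disc_area_UNIV)

lemma integrable_disc_area_compact:
  fixes f :: "complex \<Rightarrow> complex"
  assumes "continuous_on (ball 0 1) f" "compact K" "K \<subseteq> ball 0 1"
  shows "integrable disc_area (\<lambda>w. indicator K w * norm (f w))"
proof -
  interpret finite_measure disc_area by (rule finite_measure_disc_area)
  have "continuous_on K f" using assms by (blast intro: continuous_on_subset)
  then have "compact (f ` K)" using assms by (intro compact_continuous_image)
  then obtain B where B: "\<And>w. w \<in> K \<Longrightarrow> norm (f w) \<le> B"
    using compact_imp_bounded by (fastforce simp: bounded_iff)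
  have K: "K \<in> sets disc_area"
    using assms by (auto simp: sets_disc_area sets_restrict_space_iff compact_imp_closed)
  show ?thesis
  proof (rule integrable_const_bound[where B="max B 0"])
    show "AE w in disc_area. norm (indicator K w * norm (f w)) \<le> max B 0"
      using B by (auto simp: indicator_def le_max_iff_disj)
    show "(\<lambda>w. indicator K w * norm (f w)) \<in> borel_measurable disc_area"
      using borel_measurable_disc_area[OF assms(1)] K by measurable
  qed
qed

lemma integral_disc_area_compact:
  assumes "continuous_on (ball 0 1) f" "compact K" "K \<subseteq> ball 0 1"
  shows "(LINT w|lborel. indicator K w * norm (f w))
       = pi * (LINT w|disc_area. indicator K w * norm (f w :: complex))"
proof -
  have "(LINT w|disc_area. indicator K w * norm (f w))
      = (LINT w|lborel. indicator (ball 0 1) w * (indicator K w * norm (f w))) / pi"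
    by (intro integral_disc_area borel_measurable_integrable integrable_disc_area_compact assms)
  also have "(\<lambda>w. indicator (ball 0 1) w * (indicator K w * norm (f w))) = (\<lambda>w. indicator K w * norm (f w))"
    using assms(3) by (auto simp: indicator_def fun_eq_iff)
  finally show ?thesis by simp
qed

lemma ball_subset_unit_disc: "ball z (1 - norm z) \<subseteq> ball (0::complex) 1"
  by (subst ball_subset_ball_iff) (auto simp: dist_norm)

lemma cball_subset_unit_disc: "r < 1 - norm z \<Longrightarrow> cball z r \<subseteq> ball (0::complex) 1"
  by (subst cball_subset_ball_iff) (auto simp: dist_norm)

lemma norm_le_disc_area_average:
  assumes f: "f holomorphic_on ball 0 1" and r: "0 < r" "r < 1 - norm z"
  shows "norm (f z) * r\<^sup>2 \<le> (LINT w|disc_area. indicator (cball z r) w * norm (f w))"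
proof -
  note sub = cball_subset_unit_disc[OF r(2)] ball_subset_unit_disc
  have "norm (f z) * (pi * r\<^sup>2) \<le> (LINT w|lborel. indicator (cball z r) w * norm (f w))"
    using r by (intro norm_le_disc_average[where R="1 - norm z"] holomorphic_on_subset[OF f] sub) auto
  also have "\<dots> = pi * (LINT w|disc_area. indicator (cball z r) w * norm (f w))"
    using f by (intro integral_disc_area_compact sub) (auto intro: holomorphic_on_imp_continuous_on)
  finally show ?thesis by (simp add: mult.left_commute)
qed

text \<open>
  Trades a power of \<open>x\<close> for a known upper bound \<open>y\<close>; this is how an \<open>L\<^sup>1\<close> quantity is reduced to an
  \<open>L\<^sup>p\<close> quantity when \<open>p \<le> 1\<close>.
\<close>

lemma powr_split_le:
  fixes x y p :: real
  assumes "0 \<le> x" "x \<le> y" "p \<le> 1"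
  shows "x \<le> y powr (1 - p) * x powr p"
proof -
  have "x = x powr (1 - p) * x powr p" using assms by (simp flip: powr_add)
  also have "\<dots> \<le> y powr (1 - p) * x powr p"
    using assms by (intro mult_right_mono powr_mono2) auto
  finally show ?thesis .
qed

text \<open>
  For \<open>p < 1\<close> Jensen's inequality is not available to pass from the mean value inequality for \<open>|f|\<close> to one
  for \<open>|f| powr p\<close>. Instead let \<open>S\<close> be the maximum of \<open>(\<rho> - |z|) powr (2/p) * |f z|\<close> over the disc of radius
  \<open>\<rho>\<close>. At a point where it is attained, average \<open>|f|\<close> over the disc of half the distance to the boundary
  and bound \<open>|f| powr (1 - p)\<close> there by means of \<open>S\<close>. All powers of the radius cancel and
  \<open>S \<le> c S powr (1 - p) \<integral> |f| powr p\<close> remains. Since \<open>\<rho> < 1\<close>, the maximum is finite and can be divided out.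
\<close>

lemma bergman_growth_small_exponent_aux:
  assumes p: "0 < p" "p \<le> 1" and f: "f \<in> bergman_space p" and \<rho>: "0 < \<rho>" "\<rho> < 1"
    and z: "norm z \<le> \<rho>"
  shows "(\<rho> - norm z) powr (2 / p) * norm (f z)
       \<le> (2 powr (2 / p) * (LINT w|disc_area. norm (f w) powr p)) powr (1 / p)"
proof -
  have hol: "f holomorphic_on ball 0 1" and int: "integrable disc_area (\<lambda>w. norm (f w) powr p)"
    using f by (auto simp: bergman_space_def)
  define I where "I = (LINT w|disc_area. norm (f w) powr p)"
  have I0: "0 \<le> I" unfolding I_def by (rule Bochner_Integration.integral_nonneg) auto
  define g where "g w = (\<rho> - norm w) powr (2 / p) * norm (f w)" for w
  have "continuous_on (cball 0 \<rho>) f"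
    using \<rho> by (intro holomorphic_on_imp_continuous_on holomorphic_on_subset[OF hol]) auto
  then have "continuous_on (cball 0 \<rho>) g"
    unfolding g_def using p by (intro continuous_intros continuous_on_powr') auto
  then obtain z0 where z0: "z0 \<in> cball 0 \<rho>" "\<And>w. w \<in> cball 0 \<rho> \<Longrightarrow> g w \<le> g z0"
    using continuous_attains_sup[of "cball 0 \<rho>" g] \<rho> by auto
  define S where "S = g z0"
  have gS: "g w \<le> S" if "norm w \<le> \<rho>" for w using z0 that by (auto simp: S_def)
  have S0: "0 \<le> S" by (simp add: S_def g_def)
  have "S \<le> (2 powr (2 / p) * I) powr (1 / p)"
  proof (cases "S = 0")
    case False
    then have S: "S > 0" using S0 by simp
    have z0\<rho>: "norm z0 < \<rho>"
      using z0(1) False by (cases "norm z0 = \<rho>") (auto simp: S_def g_def)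
    \<comment> \<open>On the disc of radius \<open>r\<close> around \<open>z0\<close> the distance to the circle of radius \<open>\<rho>\<close> is still at least \<open>r\<close>.\<close>
    define r where "r = (\<rho> - norm z0) / 2"
    have r: "0 < r" "r < 1 - norm z0" using z0\<rho> \<rho> by (auto simp: r_def field_simps)
    have fw: "norm (f w) \<le> S * r powr (- (2 / p))" if w: "w \<in> cball z0 r" for w
    proof -
      have "norm w \<le> norm z0 + r"
        using w norm_triangle_sub[of w z0] by (auto simp: dist_norm norm_minus_commute)
      then have rw: "r \<le> \<rho> - norm w" by (simp add: r_def field_simps)
      have "r powr (2 / p) * norm (f w) \<le> g w"
        unfolding g_def using rw r p by (intro mult_right_mono powr_mono2) auto
      also have "\<dots> \<le> S" using rw r by (intro gS) auto
      finally show ?thesis using r by (simp add: powr_minus field_simps)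
    qed
    have "norm (f z0) * r\<^sup>2 \<le> (LINT w|disc_area. indicator (cball z0 r) w * norm (f w))"
      by (rule norm_le_disc_area_average[OF hol r])
    also have "\<dots> \<le> (LINT w|disc_area. (S * r powr (- (2 / p))) powr (1 - p) * norm (f w) powr p)"
    proof (intro integral_mono integrable_mult_right int integrable_disc_area_compact)
      show "continuous_on (ball 0 1) f" using hol by (rule holomorphic_on_imp_continuous_on)
      show "cball z0 r \<subseteq> ball 0 1" by (rule cball_subset_unit_disc[OF r(2)])
      show "indicator (cball z0 r) w * norm (f w)
          \<le> (S * r powr (- (2 / p))) powr (1 - p) * norm (f w) powr p" for w
        using powr_split_le[OF _ fw, of w p] p by (auto simp: indicator_def)
    qed auto
    also have "\<dots> = S powr (1 - p) * r powr (- (2 / p) * (1 - p)) * I"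
      using S0 r by (simp add: I_def powr_mult powr_powr)
    finally have *: "norm (f z0) * r\<^sup>2 \<le> S powr (1 - p) * r powr (- (2 / p) * (1 - p)) * I" .
    \<comment> \<open>The exponents are chosen so that the radius disappears from the final inequality.\<close>
    have rr: "r powr (2 / p - 2) * r powr (- (2 / p) * (1 - p)) = 1"
    proof -
      have "2 / p - 2 + (- (2 / p) * (1 - p)) = 0" using p by (simp add: field_simps)
      then show ?thesis using r by (simp flip: powr_add)
    qed
    have "2 * r = \<rho> - norm z0" by (simp add: r_def)
    then have "S = (2 * r) powr (2 / p) * norm (f z0)" by (simp only: S_def g_def)
    also have "\<dots> = 2 powr (2 / p) * (r powr (2 / p - 2) * (norm (f z0) * r\<^sup>2))"
      using r by (simp add: powr_mult powr_diff)
    also have "\<dots> \<le> 2 powr (2 / p) * (r powr (2 / p - 2) * (S powr (1 - p) * r powr (- (2 / p) * (1 - p)) * I))"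
      by (intro mult_left_mono *) auto
    also have "\<dots> = 2 powr (2 / p) * (r powr (2 / p - 2) * r powr (- (2 / p) * (1 - p))) * S powr (1 - p) * I"
      by (simp only: mult_ac)
    also have "\<dots> = (2 powr (2 / p) * I) * S powr (1 - p)" unfolding rr by (simp only: mult_1_right mult_ac)
    finally have "S * S powr (p - 1) \<le> ((2 powr (2 / p) * I) * S powr (1 - p)) * S powr (p - 1)"
      by (rule mult_right_mono) simp
    also have "S * S powr (p - 1) = S powr p"
      using S by (simp add: powr_diff)
    also have "((2 powr (2 / p) * I) * S powr (1 - p)) * S powr (p - 1) = 2 powr (2 / p) * I"
      using S by (simp add: mult.assoc flip: powr_add)
    finally have "(S powr p) powr (1 / p) \<le> (2 powr (2 / p) * I) powr (1 / p)"
      using p by (intro powr_mono2) auto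
    then show ?thesis using S p by (simp add: powr_powr)
  qed simp
  then show ?thesis using gS[OF z] unfolding g_def I_def by linarith
qed

lemma bergman_growth_small_exponent:
  fixes p :: real
  assumes p: "0 < p" "p \<le> 1"
  obtains C where "C > 0"
    "\<And>f z. f \<in> bergman_space p \<Longrightarrow> norm z < 1 \<Longrightarrow>
       norm (f z) \<le> C * bergman_norm p f * (1 - norm z) powr (- (2 / p))"
proof
  let ?C = "2 powr (2 / p) * (2 powr (2 / p)) powr (1 / p) :: real"
  show "?C > 0" by simp
  fix f z assume f: "f \<in> bergman_space p" and z: "norm (z::complex) < 1"
  let ?I = "LINT w|disc_area. norm (f w) powr p"
  \<comment> \<open>With this radius \<open>\<rho> - |z|\<close> is half of \<open>1 - |z|\<close>, so only a constant is lost.\<close>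
  define \<rho> where "\<rho> = (1 + norm z) / 2"
  have "0 < \<rho>" by (simp add: \<rho>_def add_pos_nonneg)
  moreover have "\<rho> < 1" "norm z \<le> \<rho>" using z by (simp_all add: \<rho>_def)
  ultimately have * : "(\<rho> - norm z) powr (2 / p) * norm (f z) \<le> (2 powr (2 / p) * ?I) powr (1 / p)"
    by (rule bergman_growth_small_exponent_aux[OF p f])
  have **: "\<rho> - norm z = (1 - norm z) / 2" by (simp add: \<rho>_def field_simps)
  have "((1 - norm z) powr (2 / p) / 2 powr (2 / p)) * norm (f z) \<le> (2 powr (2 / p) * ?I) powr (1 / p)"
    using * z unfolding ** by (simp add: powr_divide)
  also have "\<dots> = (2 powr (2 / p)) powr (1 / p) * bergman_norm p f"
    by (auto simp: bergman_norm_def powr_mult intro!: integral_nonneg)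
  finally show "norm (f z) \<le> ?C * bergman_norm p f * (1 - norm z) powr (- (2 / p))"
    using z by (simp add: powr_minus field_simps)
qed

text \<open>
  The inclusion of \<open>A\<^sup>p\<close> in a weighted \<open>A\<^sup>1\<close>: split off \<open>|f| powr p\<close> and apply the growth estimate to the
  remaining factor \<open>|f| powr (1 - p)\<close>.
\<close>

lemma bergman_weighted_L1:
  fixes p :: real
  assumes p: "0 < p" "p \<le> 1"
  obtains C where "C > 0"
    "\<And>f. f \<in> bergman_space p \<Longrightarrow>
       integrable disc_area (\<lambda>w. norm (f w) * (1 - norm w) powr (2 / p - 2))"
    "\<And>f. f \<in> bergman_space p \<Longrightarrow>
       (LINT w|disc_area. norm (f w) * (1 - norm w) powr (2 / p - 2)) \<le> C * bergman_norm p f"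
proof -
  obtain C where C: "C > 0"
    "\<And>f z. f \<in> bergman_space p \<Longrightarrow> norm z < 1 \<Longrightarrow>
       norm (f z) \<le> C * bergman_norm p f * (1 - norm z) powr (- (2 / p))"
    using bergman_growth_small_exponent[OF p] by blast
  show thesis
  proof (rule that[of "C powr (1 - p)"])
    show "C powr (1 - p) > 0" using C by simp
    fix f assume f: "f \<in> bergman_space p"
    then have hol: "f holomorphic_on ball 0 1" and int: "integrable disc_area (\<lambda>w. norm (f w) powr p)"
      by (auto simp: bergman_space_def)
    have N0: "0 \<le> bergman_norm p f" by (simp add: bergman_norm_def)
    let ?K = "(C * bergman_norm p f) powr (1 - p)"
    have pt: "norm (f w) * (1 - norm w) powr (2 / p - 2) \<le> ?K * norm (f w) powr p"
      if "w \<in> space disc_area" for w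
    proof -
      have w: "norm w < 1" using that by simp
      have "norm (f w) \<le> (C * bergman_norm p f * (1 - norm w) powr (- (2 / p))) powr (1 - p) * norm (f w) powr p"
        using p by (intro powr_split_le C f w) auto
      also have "\<dots> = ?K * (1 - norm w) powr (- (2 / p) * (1 - p)) * norm (f w) powr p"
        using C N0 w by (simp add: powr_mult powr_powr)
      also have "- (2 / p) * (1 - p) = 2 - 2 / p" using p by (simp add: field_simps)
      finally have "norm (f w) * (1 - norm w) powr (2 / p - 2)
          \<le> (?K * (1 - norm w) powr (2 - 2 / p) * norm (f w) powr p) * (1 - norm w) powr (2 / p - 2)"
        by (rule mult_right_mono) simp
      also have "\<dots> = ?K * norm (f w) powr p * ((1 - norm w) powr (2 - 2 / p) * (1 - norm w) powr (2 / p - 2))"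
        by (simp only: mult_ac)
      also have "(1 - norm w) powr (2 - 2 / p) * (1 - norm w) powr (2 / p - 2) = 1"
        using w by (simp flip: powr_add)
      finally show ?thesis by simp
    qed
    have cf: "continuous_on (ball 0 1) f" using hol by (rule holomorphic_on_imp_continuous_on)
    have m: "(\<lambda>w. norm (f w) * (1 - norm w) powr (2 / p - 2)) \<in> borel_measurable disc_area"
      by (intro borel_measurable_disc_area continuous_intros cf) auto
    show i: "integrable disc_area (\<lambda>w. norm (f w) * (1 - norm w) powr (2 / p - 2))"
      using pt by (intro Bochner_Integration.integrable_bound[OF integrable_mult_right[OF int, of ?K] m] AE_I2) (auto simp: abs_mult)
    have "(LINT w|disc_area. norm (f w) * (1 - norm w) powr (2 / p - 2))
        \<le> (LINT w|disc_area. ?K * norm (f w) powr p)"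
      by (intro integral_mono i integrable_mult_right int pt)
    also have "\<dots> = ?K * bergman_norm p f powr p"
    proof -
      have "0 \<le> (LINT w|disc_area. norm (f w) powr p)" by (rule Bochner_Integration.integral_nonneg) auto
      then show ?thesis using p by (simp add: bergman_norm_def powr_powr)
    qed
    also have "\<dots> = C powr (1 - p) * bergman_norm p f"
      using C N0 by (simp add: powr_mult mult.assoc flip: powr_add)
    finally show "(LINT w|disc_area. norm (f w) * (1 - norm w) powr (2 / p - 2))
        \<le> C powr (1 - p) * bergman_norm p f" .
  qed
qed

text \<open>
  On this annulus \<open>|w| ^ (2 k)\<close> is at least \<open>1/2\<close> by Bernoulli's inequality, and the normalised area of the
  annulus is at least \<open>1 / (8 n)\<close>; the factor \<open>16 n\<close> is the product of the reciprocals.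
\<close>

lemma taylor_coeff_le_disc_area_integral:
  fixes f :: "complex \<Rightarrow> complex" and k :: nat
  assumes f: "f holomorphic_on ball 0 1"
  defines "n \<equiv> real k + 1"
  defines "A \<equiv> annulus (1 - 1 / (4 * n)) (1 - 1 / (8 * n))"
  shows "norm (taylor_coeff f k) \<le> 16 * n * (LINT w|disc_area. indicator A w * norm (f w))"
    and "integrable disc_area (\<lambda>w. indicator A w * norm (f w))"
proof -
  define r1 where "r1 = 1 - 1 / (4 * n)"
  define r2 where "r2 = 1 - 1 / (8 * n)"
  have n: "n \<ge> 1" by (simp add: n_def)
  have r: "0 \<le> r1" "r1 \<le> r2" "r2 < 1" using n by (auto simp: r1_def r2_def field_simps)
  have A: "A = annulus r1 r2" by (simp add: A_def r1_def r2_def)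
  have K: "compact A" "A \<subseteq> ball 0 1" using r unfolding A by (auto intro: compact_annulus)
  have cf: "continuous_on (ball 0 1) f" using f by (rule holomorphic_on_imp_continuous_on)
  show "integrable disc_area (\<lambda>w. indicator A w * norm (f w))"
    by (rule integrable_disc_area_compact[OF cf K])
  let ?J = "LINT w|disc_area. indicator A w * norm (f w)"
  have J0: "0 \<le> ?J" by (rule Bochner_Integration.integral_nonneg) auto
  have pow: "1 / 2 \<le> r1 ^ (2 * k)"
  proof -
    have "1 / 2 \<le> 1 + real (2 * k) * (- 1 / (4 * n))" by (simp add: n_def field_simps)
    also have "\<dots> \<le> (1 + (- 1 / (4 * n))) ^ (2 * k)"
      using n by (intro Bernoulli_inequality) (auto simp: field_simps)
    finally show ?thesis by (simp add: r1_def)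
  qed
  have area: "1 / (8 * n) \<le> r2\<^sup>2 - r1\<^sup>2"
    using n by (simp add: r1_def r2_def power2_eq_square field_simps)
  have "norm (taylor_coeff f k) * (1 / 2 * (pi * (1 / (8 * n))))
      \<le> norm (taylor_coeff f k) * (r1 ^ (2 * k) * (pi * (r2\<^sup>2 - r1\<^sup>2)))"
    using pow area r n by (intro mult_left_mono mult_mono) auto
  also have "\<dots> \<le> r2 ^ k * (pi * ?J)"
    using taylor_coeff_le_annulus_integral[OF f r, of k] integral_disc_area_compact[OF cf K]
    by (simp add: A)
  also have "\<dots> \<le> 1 * (pi * ?J)"
    using r J0 by (intro mult_right_mono power_le_one) auto
  finally show "norm (taylor_coeff f k) \<le> 16 * n * ?J"
    using n by (simp add: field_simps)
qed

text \<open>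
  A point at distance \<open>x\<close> from the circle lies in the annulus of index \<open>k\<close> only if \<open>k + 1\<close> is between
  \<open>1/(8 x)\<close> and \<open>1/(4 x)\<close>. There are at most \<open>1/(4 x)\<close> such indices, and for each of them
  \<open>(k + 1) powr (1 - \<kappa>)\<close> is at most \<open>(8 x) powr (\<kappa> - 1)\<close>.
\<close>

lemma sum_over_annuli_le:
  fixes \<kappa> :: real and w :: complex
  assumes \<kappa>: "\<kappa> \<ge> 1" and w: "norm w < 1"
  shows "(\<Sum>k<N. indicator (annulus (1 - 1 / (4 * (real k + 1))) (1 - 1 / (8 * (real k + 1)))) w
           * (real k + 1) powr (1 - \<kappa>))
       \<le> 2 * 8 powr (\<kappa> - 2) * (1 - norm w) powr (\<kappa> - 2)"
proof -
  define x where "x = 1 - norm w"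
  have x: "x > 0" using w by (simp add: x_def)
  define m where "m = nat \<lfloor>1 / (4 * x)\<rfloor>"
  have m: "real m \<le> 1 / (4 * x)" using x by (simp add: m_def)
  have summand: "indicator (annulus (1 - 1 / (4 * (real k + 1))) (1 - 1 / (8 * (real k + 1)))) w
        * (real k + 1) powr (1 - \<kappa>) \<le> (if k < m then (8 * x) powr (\<kappa> - 1) else 0)" for k
  proof (cases "w \<in> annulus (1 - 1 / (4 * (real k + 1))) (1 - 1 / (8 * (real k + 1)))")
    case True
    then have a: "1 / (8 * (real k + 1)) \<le> x" "x \<le> 1 / (4 * (real k + 1))"
      by (auto simp: x_def)
    have k1: "1 / (8 * x) \<le> real k + 1" "real k + 1 \<le> 1 / (4 * x)"
      using a x by (simp_all add: field_simps)
    have "k < m" unfolding m_def using k1(2) by linarith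
    moreover have "(real k + 1) powr (1 - \<kappa>) \<le> (1 / (8 * x)) powr (1 - \<kappa>)"
      using k1(1) x \<kappa> by (intro powr_mono2') auto
    moreover have "(1 / (8 * x)) powr (1 - \<kappa>) = (8 * x) powr (\<kappa> - 1)"
      using x by (simp add: powr_divide powr_diff)
    ultimately show ?thesis using True by simp
  qed auto
  have "(\<Sum>k<N. indicator (annulus (1 - 1 / (4 * (real k + 1))) (1 - 1 / (8 * (real k + 1)))) w
           * (real k + 1) powr (1 - \<kappa>)) \<le> (\<Sum>k<N. if k < m then (8 * x) powr (\<kappa> - 1) else 0)"
    by (intro sum_mono summand)
  also have "\<dots> = (\<Sum>k\<in>{..<N} \<inter> {..<m}. (8 * x) powr (\<kappa> - 1))"
    by (subst sum.inter_restrict) (auto intro!: sum.cong)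
  also have "\<dots> \<le> (\<Sum>k<m. (8 * x) powr (\<kappa> - 1))"
    by (intro sum_mono2) auto
  also have "\<dots> = real m * (8 * x) powr (\<kappa> - 1)" by simp
  also have "\<dots> \<le> 1 / (4 * x) * (8 * x) powr (\<kappa> - 1)"
    by (intro mult_right_mono m) simp
  also have "(8 * x) powr (\<kappa> - 1) = (8 * x) powr (\<kappa> - 2) * (8 * x)"
    using x powr_add[of "8 * x" "\<kappa> - 2" 1] by simp
  also have "1 / (4 * x) * ((8 * x) powr (\<kappa> - 2) * (8 * x)) = 2 * (8 * x) powr (\<kappa> - 2)"
    using x by simp
  also have "\<dots> = 2 * 8 powr (\<kappa> - 2) * x powr (\<kappa> - 2)"
    using x by (simp add: powr_mult)
  finally show ?thesis by (simp add: x_def)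
qed

text \<open>
  A Hardy-type inequality. Estimating each \<open>|a\<^sub>k|\<close> on its own by \<open>C k powr (2/p - 1)\<close> would leave the harmonic series;
  localising \<open>a\<^sub>k\<close> to an annulus at scale \<open>1/k\<close> and summing under the integral avoids this.
\<close>

lemma bergman_coefficients_summable:
  fixes p :: real
  assumes p: "0 < p" "p \<le> 1"
  obtains C where "C > 0"
    "\<And>f. f \<in> bergman_space p \<Longrightarrow> summable (\<lambda>k. (real k + 1) powr (- (2 / p)) * norm (taylor_coeff f k))"
    "\<And>f. f \<in> bergman_space p \<Longrightarrow>
       (\<Sum>k. (real k + 1) powr (- (2 / p)) * norm (taylor_coeff f k)) \<le> C * bergman_norm p f"
proof -
  obtain C where C: "C > 0"
    "\<And>f. f \<in> bergman_space p \<Longrightarrow>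
       integrable disc_area (\<lambda>w. norm (f w) * (1 - norm w) powr (2 / p - 2))"
    "\<And>f. f \<in> bergman_space p \<Longrightarrow>
       (LINT w|disc_area. norm (f w) * (1 - norm w) powr (2 / p - 2)) \<le> C * bergman_norm p f"
    using bergman_weighted_L1[OF p] by blast
  define D where "D = 16 * (2 * 8 powr (2 / p - 2)) * C"
  have part: "(\<Sum>k<N. (real k + 1) powr (- (2 / p)) * norm (taylor_coeff f k)) \<le> D * bergman_norm p f"
    if f: "f \<in> bergman_space p" for f N
  proof -
    have hol: "f holomorphic_on ball 0 1" using f by (simp add: bergman_space_def)
    define A where "A k = annulus (1 - 1 / (4 * (real k + 1))) (1 - 1 / (8 * (real k + 1)))" for k
    note coeff = taylor_coeff_le_disc_area_integral[OF hol, folded A_def]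
    have "(\<Sum>k<N. (real k + 1) powr (- (2 / p)) * norm (taylor_coeff f k))
        \<le> (\<Sum>k<N. 16 * (LINT w|disc_area. (real k + 1) powr (1 - 2 / p) * (indicator (A k) w * norm (f w))))"
    proof (intro sum_mono)
      fix k
      have "(real k + 1) powr (- (2 / p)) * norm (taylor_coeff f k)
          \<le> (real k + 1) powr (- (2 / p)) * (16 * (real k + 1) * (LINT w|disc_area. indicator (A k) w * norm (f w)))"
        by (intro mult_left_mono coeff) auto
      also have "\<dots> = 16 * (((real k + 1) powr (- (2 / p)) * (real k + 1)) * (LINT w|disc_area. indicator (A k) w * norm (f w)))"
        by (simp only: mult_ac)
      also have "(real k + 1) powr (- (2 / p)) * (real k + 1) = (real k + 1) powr (1 - 2 / p)"
        using powr_add[of "real k + 1" "- (2 / p)" 1] by simp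
      finally show "(real k + 1) powr (- (2 / p)) * norm (taylor_coeff f k)
          \<le> 16 * (LINT w|disc_area. (real k + 1) powr (1 - 2 / p) * (indicator (A k) w * norm (f w)))"
        by simp
    qed
    also have "\<dots> = 16 * (LINT w|disc_area. (\<Sum>k<N. (real k + 1) powr (1 - 2 / p) * (indicator (A k) w * norm (f w))))"
      using coeff(2) by (subst Bochner_Integration.integral_sum) (auto simp: sum_distrib_left)
    also have "\<dots> \<le> 16 * (LINT w|disc_area. (2 * 8 powr (2 / p - 2)) * (norm (f w) * (1 - norm w) powr (2 / p - 2)))"
    proof (intro mult_left_mono integral_mono)
      show "integrable disc_area (\<lambda>w. \<Sum>k<N. (real k + 1) powr (1 - 2 / p) * (indicator (A k) w * norm (f w)))"
        using coeff(2) by (intro Bochner_Integration.integrable_sum integrable_mult_right)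
      show "integrable disc_area (\<lambda>w. (2 * 8 powr (2 / p - 2)) * (norm (f w) * (1 - norm w) powr (2 / p - 2)))"
        using C(2)[OF f] by (rule integrable_mult_right)
      fix w assume "w \<in> space disc_area"
      then have w: "norm w < 1" by simp
      have "(\<Sum>k<N. (real k + 1) powr (1 - 2 / p) * (indicator (A k) w * norm (f w)))
          = (\<Sum>k<N. indicator (A k) w * (real k + 1) powr (1 - 2 / p)) * norm (f w)"
        unfolding sum_distrib_right by (intro sum.cong refl) (simp only: mult_ac)
      also have "\<dots> \<le> (2 * 8 powr (2 / p - 2) * (1 - norm w) powr (2 / p - 2)) * norm (f w)"
        unfolding A_def using p w by (intro mult_right_mono sum_over_annuli_le) (auto simp: field_simps)
      finally show "(\<Sum>k<N. (real k + 1) powr (1 - 2 / p) * (indicator (A k) w * norm (f w)))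
          \<le> (2 * 8 powr (2 / p - 2)) * (norm (f w) * (1 - norm w) powr (2 / p - 2))"
        by (simp only: mult_ac)
    qed simp
    also have "\<dots> = 16 * (2 * 8 powr (2 / p - 2)) * (LINT w|disc_area. norm (f w) * (1 - norm w) powr (2 / p - 2))"
      by simp
    also have "\<dots> \<le> 16 * (2 * 8 powr (2 / p - 2)) * (C * bergman_norm p f)"
      by (intro mult_left_mono C(3) f) auto
    finally show ?thesis by (simp add: D_def mult.assoc)
  qed
  show thesis
  proof (rule that[of D])
    show "D > 0" using C by (simp add: D_def)
    fix f assume f: "f \<in> bergman_space p"
    show s: "summable (\<lambda>k. (real k + 1) powr (- (2 / p)) * norm (taylor_coeff f k))"
      by (rule bounded_imp_summable[where B="D * bergman_norm p f"])
        (use part[OF f, of "Suc _"] in \<open>auto simp: lessThan_Suc_atMost\<close>)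
    show "(\<Sum>k. (real k + 1) powr (- (2 / p)) * norm (taylor_coeff f k)) \<le> D * bergman_norm p f"
      by (intro suminf_le_const s part f)
  qed
qed

section \<open>Carleson measures and the embedding of Bergman spaces\<close>

lemma space_unit_measure:
  assumes "borel_measure_on_unit \<nu>"
  shows "space \<nu> = {0..<1}"
  using assms sets_eq_imp_space_eq[of \<nu> "restrict_space borel {0..<1}"]
  by (simp add: borel_measure_on_unit_def space_restrict_space)

lemma sets_unit_measure:
  assumes "borel_measure_on_unit \<nu>" "A \<in> sets borel" "A \<subseteq> {0..<1}"
  shows "A \<in> sets \<nu>"
  using assms by (simp add: borel_measure_on_unit_def sets_restrict_space_iff)

lemma borel_measurable_unit_measure:
  assumes "borel_measure_on_unit \<nu>" "continuous_on {0..<1} f"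
  shows "f \<in> borel_measurable \<nu>"
proof -
  have "sets \<nu> = sets (restrict_space borel {0..<1})"
    using assms(1) by (simp add: borel_measure_on_unit_def)
  from measurable_cong_sets[OF this refl] show ?thesis
    using borel_measurable_continuous_on_restrict[OF assms(2)] by blast
qed

text \<open>
  Cut \<open>[t, 1)\<close> at the points \<open>x\<^sub>j\<close> whose distance to 1 is \<open>(1 - t) / 2 ^ j\<close>. On each piece \<open>W\<close> is at most \<open>D\<close>
  times its value at the left end, so the tail bound applies to the piece and the contributions form a geometric
  series of ratio \<open>2 powr (-s)\<close>.
\<close>

lemma tail_weighted_le:
  fixes W :: "real \<Rightarrow> real"
  assumes \<mu>: "borel_measure_on_unit \<mu>" and cont: "continuous_on {0..<1} W"
    and nonneg: "\<And>t. 0 \<le> t \<Longrightarrow> t < 1 \<Longrightarrow> 0 \<le> W t"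
    and mono: "\<And>t u. 0 \<le> t \<Longrightarrow> t \<le> u \<Longrightarrow> u < 1 \<Longrightarrow> W t \<le> W u"
    and doubling: "\<And>t. 0 \<le> t \<Longrightarrow> t < 1 \<Longrightarrow> W ((1 + t) / 2) \<le> D * W t"
    and tail: "\<And>t. 0 \<le> t \<Longrightarrow> t < 1 \<Longrightarrow> emeasure \<mu> {t..<1} * ennreal (W t) \<le> ennreal (M * (1 - t) powr s)"
    and s: "s > 0" and M: "M > 0" and D: "D > 0" and t: "0 \<le> t" "t < 1"
  shows "emeasure (density \<mu> (\<lambda>x. ennreal (W x))) {t..<1}
       \<le> ennreal (D * M / (1 - 2 powr (- s)) * (1 - t) powr s)"
proof -
  let ?\<nu> = "density \<mu> (\<lambda>x. ennreal (W x))"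
  have Wm [measurable]: "W \<in> borel_measurable \<mu>"
    by (rule borel_measurable_unit_measure[OF \<mu> cont])
  define x where "x j = 1 - (1 - t) / 2 ^ j" for j
  have x: "t \<le> x j" "x j < 1" "0 \<le> x j" for j
  proof -
    have "(1 - t) / 2 ^ j \<le> (1 - t) / 1" using t by (intro divide_left_mono) auto
    then show "t \<le> x j" by (simp add: x_def)
    then show "0 \<le> x j" using t by simp
    show "x j < 1" using t by (simp add: x_def)
  qed
  have xSuc: "x (Suc j) = (1 + x j) / 2" for j by (simp add: x_def field_simps)
  have sets: "{x j..<x (Suc j)} \<in> sets \<mu>" "{x j..<1} \<in> sets \<mu>" for j
    using x[of j] x[of "Suc j"] by (auto intro!: sets_unit_measure[OF \<mu>])
  have cover: "{t..<1} = (\<Union>j. {x j..<x (Suc j)})"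
  proof (intro equalityI subsetI)
    fix y assume y: "y \<in> {t..<1}"
    have "x \<longlonglongrightarrow> 1 - 0"
      unfolding x_def by (intro tendsto_diff tendsto_const) real_asymp
    then have "\<forall>\<^sub>F j in sequentially. y < x j"
      using y by (intro order_tendstoD(1)[where a = y]) auto
    then have ex: "\<exists>j. y < x j" by (auto simp: eventually_sequentially)
    define k where "k = (LEAST j. y < x j)"
    have k: "y < x k" unfolding k_def using ex by (rule LeastI_ex)
    then have "k \<noteq> 0" using y by (auto simp: x_def intro: gr0I)
    then obtain j where j: "k = Suc j" by (cases k) auto
    have "\<not> y < x j" using not_less_Least[of j "\<lambda>j. y < x j"] j by (simp add: k_def)
    then show "y \<in> (\<Union>j. {x j..<x (Suc j)})" using k j by force
  next
    fix y assume "y \<in> (\<Union>j. {x j..<x (Suc j)})"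
    then obtain j where "x j \<le> y" "y < x (Suc j)" by auto
    then show "y \<in> {t..<1}" using x[of j] x[of "Suc j"] by auto
  qed
  have piece: "emeasure ?\<nu> {x j..<x (Suc j)} \<le> ennreal (D * M * (1 - t) powr s * (2 powr (- s)) ^ j)" for j
  proof -
    have "emeasure ?\<nu> {x j..<x (Suc j)} = (\<integral>\<^sup>+y. ennreal (W y) * indicator {x j..<x (Suc j)} y \<partial>\<mu>)"
      using sets by (subst emeasure_density) auto
    also have "\<dots> \<le> (\<integral>\<^sup>+y. ennreal (D * W (x j)) * indicator {x j..<1} y \<partial>\<mu>)"
    proof (intro nn_integral_mono)
      fix y
      show "ennreal (W y) * indicator {x j..<x (Suc j)} y \<le> ennreal (D * W (x j)) * indicator {x j..<1} y"
      proof (cases "y \<in> {x j..<x (Suc j)}")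
        case True
        then have "W y \<le> W (x (Suc j))" using x[of j] x[of "Suc j"] by (intro mono) auto
        also have "\<dots> \<le> D * W (x j)" unfolding xSuc by (intro doubling x)
        finally show ?thesis using True x[of "Suc j"] by (auto intro!: ennreal_leI)
      qed simp
    qed
    also have "\<dots> = ennreal D * (emeasure \<mu> {x j..<1} * ennreal (W (x j)))"
      using sets D by (subst nn_integral_cmult_indicator) (auto simp: ennreal_mult' mult_ac)
    also have "\<dots> \<le> ennreal D * ennreal (M * (1 - x j) powr s)"
      by (intro mult_left_mono tail x) auto
    also have "\<dots> = ennreal (D * M * (1 - x j) powr s)"
      using D M by (simp add: mult.assoc flip: ennreal_mult')
    also have "(1 - x j) powr s = (1 - t) powr s * (2 powr (- s)) ^ j"
    proof -
      have "(2 powr (- s)) ^ j = (2::real) powr (- s * real j)" by (simp add: powr_power mult.commute)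
      also have "\<dots> = 1 / (2 ^ j) powr s"
        by (simp add: powr_minus powr_powr mult.commute inverse_eq_divide flip: powr_realpow)
      finally show ?thesis using t by (simp add: x_def powr_divide)
    qed
    finally show ?thesis by (simp add: mult.assoc)
  qed
  have lt1: "2 powr (- s) < (1::real)" using s powr_less_cancel_iff[of 2 "- s" 0] by simp
  have "emeasure ?\<nu> {t..<1} \<le> (\<Sum>j. emeasure ?\<nu> {x j..<x (Suc j)})"
    unfolding cover by (rule emeasure_subadditive_countably) (use sets in auto)
  also have "\<dots> \<le> (\<Sum>j. ennreal (D * M * (1 - t) powr s * (2 powr (- s)) ^ j))"
    by (intro suminf_le piece) auto
  also have "\<dots> = ennreal (\<Sum>j. D * M * (1 - t) powr s * (2 powr (- s)) ^ j)"
    using D M lt1 by (intro suminf_ennreal2 summable_mult summable_geometric) auto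
  also have "(\<Sum>j. D * M * (1 - t) powr s * (2 powr (- s)) ^ j) = D * M * (1 - t) powr s * (1 / (1 - 2 powr (- s)))"
    using lt1 by (subst suminf_mult) (auto simp: suminf_geometric summable_geometric)
  finally show ?thesis by (simp add: mult_ac)
qed

text \<open>
  With \<open>n = k + 1\<close>, the function \<open>t ^ k\<close> is at most \<open>exp (1 - j)\<close> where \<open>j\<close> is the integer part of
  \<open>n (1 - t)\<close>, and such \<open>t\<close> lie in the tail starting at \<open>1 - (j + 1)/n\<close>. The constant \<open>K\<close> is uniform in the
  measure and in \<open>k\<close>, since it is the sum of a series depending on \<open>s\<close> only.
\<close>

lemma moments_le_of_tail:
  fixes s :: real
  assumes s: "s > 0"
  obtains K where "K > 0"
    "\<And>\<nu> M k. borel_measure_on_unit \<nu> \<Longrightarrow> M > 0 \<Longrightarrow>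
       (\<And>t. 0 \<le> t \<Longrightarrow> t < 1 \<Longrightarrow> emeasure \<nu> {t..<1} \<le> ennreal (M * (1 - t) powr s)) \<Longrightarrow>
       (\<integral>\<^sup>+t. ennreal (t ^ k) \<partial>\<nu>) \<le> ennreal (K * M * (real k + 1) powr (- s))"
proof -
  define g where "g j = exp (1 - real j) * (real j + 1) powr s" for j :: nat
  have g0: "g j > 0" for j by (simp add: g_def)
  have sg: "summable g"
  proof (rule summable_comparison_test_bigo)
    show "summable (\<lambda>n. norm (1 / real n ^ 2))" using inverse_power_summable[of 2] by (simp add: inverse_eq_divide)
    show "g \<in> O(\<lambda>n. 1 / real n ^ 2)" unfolding g_def using s by real_asymp
  qed
  show thesis
  proof (rule that[of "suminf g"])
    show "suminf g > 0" by (intro suminf_pos sg g0)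
    fix \<nu> M k
    assume \<nu>: "borel_measure_on_unit \<nu>" and M: "M > (0::real)"
      and tail: "\<And>t. 0 \<le> t \<Longrightarrow> t < 1 \<Longrightarrow> emeasure \<nu> {t..<1} \<le> ennreal (M * (1 - t) powr s)"
    define n where "n = real k + 1"
    have n: "n \<ge> 1" by (simp add: n_def)
    \<comment> \<open>The index \<open>j = n\<close> occurs at \<open>t = 0\<close>, and without the maximum its tail would start below 0.\<close>
    define b where "b j = max 0 (1 - (real j + 1) / n)" for j :: nat
    have b: "0 \<le> b j" "b j < 1" for j using n by (auto simp: b_def)
    have sets: "{b j..<1} \<in> sets \<nu>" for j
      using b by (intro sets_unit_measure[OF \<nu>]) auto
    have tb: "emeasure \<nu> {b j..<1} \<le> ennreal (M * ((real j + 1) powr s * n powr (- s)))" for j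
    proof -
      have "emeasure \<nu> {b j..<1} \<le> ennreal (M * (1 - b j) powr s)" by (intro tail b)
      also have "\<dots> \<le> ennreal (M * ((real j + 1) / n) powr s)"
        using M s b by (intro ennreal_leI mult_left_mono powr_mono2) (auto simp: b_def less_imp_le)
      also have "((real j + 1) / n) powr s = (real j + 1) powr s * n powr (- s)"
        using n by (simp add: powr_divide powr_minus inverse_eq_divide)
      finally show ?thesis .
    qed
    have pt: "ennreal (t ^ k) \<le> (\<Sum>j. ennreal (exp (1 - real j)) * indicator {b j..<1} t)"
      if "t \<in> space \<nu>" for t
    proof -
      have t: "0 \<le> t" "t < 1" using that by (auto simp: space_unit_measure[OF \<nu>])
      define j where "j = nat \<lfloor>n * (1 - t)\<rfloor>"
      have j: "real j \<le> n * (1 - t)" "n * (1 - t) < real j + 1"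
        using t n by (auto simp: j_def)
      have "t ^ k \<le> exp (- (1 - t)) ^ k"
        using t exp_ge_add_one_self[of "- (1 - t)"] by (intro power_mono) auto
      also have "\<dots> = exp (- (real k * (1 - t)))"
        by (simp only: exp_of_nat_mult[symmetric] mult_minus_right)
      also have "\<dots> \<le> exp (1 - real j)"
        using j t by (simp add: n_def algebra_simps)
      finally have tk: "t ^ k \<le> exp (1 - real j)" .
      have "ennreal (t ^ k) \<le> ennreal (exp (1 - real j)) * indicator {b j..<1} t"
      proof -
        have "1 - (real j + 1) / n \<le> t" using j n by (simp add: field_simps)
        then have "t \<in> {b j..<1}" using t by (auto simp: b_def)
        then show ?thesis using tk by (simp add: ennreal_leI)
      qed
      also have "\<dots> \<le> (\<Sum>j. ennreal (exp (1 - real j)) * indicator {b j..<1} t)"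
      proof -
        define h where "h = (\<lambda>i. ennreal (exp (1 - real i)) * indicator {b i..<1} t)"
        have "h j \<le> suminf h" using sum_le_suminf[of h "{j}"] by simp
        then show ?thesis by (simp only: h_def)
      qed
      finally show ?thesis .
    qed
    have "(\<integral>\<^sup>+t. ennreal (t ^ k) \<partial>\<nu>) \<le> (\<integral>\<^sup>+t. (\<Sum>j. ennreal (exp (1 - real j)) * indicator {b j..<1} t) \<partial>\<nu>)"
      by (intro nn_integral_mono pt)
    also have "\<dots> = (\<Sum>j. \<integral>\<^sup>+t. ennreal (exp (1 - real j)) * indicator {b j..<1} t \<partial>\<nu>)"
      using sets by (intro nn_integral_suminf) auto
    also have "\<dots> = (\<Sum>j. ennreal (exp (1 - real j)) * emeasure \<nu> {b j..<1})"
      using sets by (simp add: nn_integral_cmult_indicator)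
    also have "\<dots> \<le> (\<Sum>j. ennreal ((M * n powr (- s)) * g j))"
    proof (intro suminf_le)
      fix j
      have "ennreal (exp (1 - real j)) * emeasure \<nu> {b j..<1}
          \<le> ennreal (exp (1 - real j)) * ennreal (M * ((real j + 1) powr s * n powr (- s)))"
        by (intro mult_left_mono tb) auto
      also have "\<dots> = ennreal (exp (1 - real j) * (M * ((real j + 1) powr s * n powr (- s))))"
        by (rule ennreal_mult'[symmetric]) simp
      also have "exp (1 - real j) * (M * ((real j + 1) powr s * n powr (- s))) = (M * n powr (- s)) * g j"
        by (simp add: g_def)
      finally show "ennreal (exp (1 - real j)) * emeasure \<nu> {b j..<1} \<le> ennreal ((M * n powr (- s)) * g j)" .
    qed auto
    also have "\<dots> = ennreal (\<Sum>j. (M * n powr (- s)) * g j)"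
      using M g0 sg by (intro suminf_ennreal2 summable_mult) (auto simp: less_imp_le)
    also have "(\<Sum>j. (M * n powr (- s)) * g j) = suminf g * M * (real k + 1) powr (- s)"
      using sg by (subst suminf_mult) (auto simp: n_def)
    finally show "(\<integral>\<^sup>+t. ennreal (t ^ k) \<partial>\<nu>) \<le> ennreal (suminf g * M * (real k + 1) powr (- s))" .
  qed
qed

lemma taylor_coeff_sums:
  assumes "f holomorphic_on ball 0 1" "norm z < 1"
  shows "(\<lambda>k. taylor_coeff f k * z ^ k) sums f z"
  using holomorphic_power_series[OF assms(1), of z] assms(2)
  by (simp add: taylor_coeff_def fps_expansion_def)

lemma summable_norm_taylor_coeff:
  assumes "f holomorphic_on ball 0 1" "0 \<le> t" "t < 1"
  shows "summable (\<lambda>k. norm (taylor_coeff f k) * t ^ k)"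
proof -
  have "summable (\<lambda>k. norm (taylor_coeff f k * of_real t ^ k))"
  proof (rule powser_insidea)
    show "summable (\<lambda>k. taylor_coeff f k * of_real ((t + 1) / 2) ^ k)"
      using assms by (intro sums_summable[OF taylor_coeff_sums[OF assms(1)]])
        (auto simp del: of_real_add of_real_divide)
    show "norm (of_real t :: complex) < norm (of_real ((t + 1) / 2) :: complex)"
      using assms by (auto simp del: of_real_add of_real_divide)
  qed
  then show ?thesis using assms by (simp add: norm_mult norm_power)
qed

lemma continuous_on_real_trace:
  assumes "f holomorphic_on ball 0 1"
  shows "continuous_on {0..<1} (\<lambda>t. f (complex_of_real t))"
  by (rule continuous_on_compose2[OF holomorphic_on_imp_continuous_on[OF assms]])
    (auto intro!: continuous_intros)

text \<open>
  The stronger first bound, on the majorant \<open>\<Sum> |a\<^sub>k| t\<^sup>k\<close>, is what justifies exchanging series and integral in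
  the definition of the operator.
\<close>

lemma carleson_embedding:
  fixes p :: real
  assumes p: "0 < p" "p \<le> 1" and \<nu>: "borel_measure_on_unit \<nu>" and M: "M > 0"
    and tail: "\<And>t. 0 \<le> t \<Longrightarrow> t < 1 \<Longrightarrow> emeasure \<nu> {t..<1} \<le> ennreal (M * (1 - t) powr (2 / p))"
  obtains C where "C > 0"
    "\<And>f. f \<in> bergman_space p \<Longrightarrow>
       (\<integral>\<^sup>+t. (\<Sum>k. ennreal (norm (taylor_coeff f k) * t ^ k)) \<partial>\<nu>) \<le> ennreal (C * bergman_norm p f)"
    "\<And>f. f \<in> bergman_space p \<Longrightarrow>
       (\<integral>\<^sup>+t. ennreal (norm (f (of_real t))) \<partial>\<nu>) \<le> ennreal (C * bergman_norm p f)"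
proof -
  have s: "2 / p > 0" using p by simp
  obtain K where K: "K > 0" and mom:
    "\<And>\<nu> M k. borel_measure_on_unit \<nu> \<Longrightarrow> M > 0 \<Longrightarrow>
       (\<And>t. 0 \<le> t \<Longrightarrow> t < 1 \<Longrightarrow> emeasure \<nu> {t..<1} \<le> ennreal (M * (1 - t) powr (2 / p))) \<Longrightarrow>
       (\<integral>\<^sup>+t. ennreal (t ^ k) \<partial>\<nu>) \<le> ennreal (K * M * (real k + 1) powr (- (2 / p)))"
    using moments_le_of_tail[OF s] by blast
  obtain C where C: "C > 0"
    "\<And>f. f \<in> bergman_space p \<Longrightarrow> summable (\<lambda>k. (real k + 1) powr (- (2 / p)) * norm (taylor_coeff f k))"
    "\<And>f. f \<in> bergman_space p \<Longrightarrow>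
       (\<Sum>k. (real k + 1) powr (- (2 / p)) * norm (taylor_coeff f k)) \<le> C * bergman_norm p f"
    using bergman_coefficients_summable[OF p] by blast
  have maj: "(\<integral>\<^sup>+t. (\<Sum>k. ennreal (norm (taylor_coeff f k) * t ^ k)) \<partial>\<nu>) \<le> ennreal (K * M * C * bergman_norm p f)"
    if f: "f \<in> bergman_space p" for f
  proof -
    have m: "(\<lambda>t. ennreal (t ^ k)) \<in> borel_measurable \<nu>" for k
    proof -
      have "(\<lambda>t. t ^ k) \<in> borel_measurable \<nu>"
        by (intro borel_measurable_unit_measure[OF \<nu>] continuous_intros)
      then show ?thesis by measurable
    qed
    have "(\<integral>\<^sup>+t. (\<Sum>k. ennreal (norm (taylor_coeff f k) * t ^ k)) \<partial>\<nu>)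
        = (\<Sum>k. \<integral>\<^sup>+t. ennreal (norm (taylor_coeff f k)) * ennreal (t ^ k) \<partial>\<nu>)"
      unfolding ennreal_mult'[OF norm_ge_zero] using m by (intro nn_integral_suminf) auto
    also have "\<dots> = (\<Sum>k. ennreal (norm (taylor_coeff f k)) * (\<integral>\<^sup>+t. ennreal (t ^ k) \<partial>\<nu>))"
      using m by (simp add: nn_integral_cmult)
    also have "\<dots> \<le> (\<Sum>k. ennreal (norm (taylor_coeff f k)) * ennreal (K * M * (real k + 1) powr (- (2 / p))))"
      by (intro suminf_le mult_left_mono mom[OF \<nu> M tail]) auto
    also have "\<dots> = (\<Sum>k. ennreal ((K * M) * ((real k + 1) powr (- (2 / p)) * norm (taylor_coeff f k))))"
    proof (intro suminf_cong)
      fix k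
      have "ennreal (norm (taylor_coeff f k)) * ennreal (K * M * (real k + 1) powr (- (2 / p)))
          = ennreal (norm (taylor_coeff f k) * (K * M * (real k + 1) powr (- (2 / p))))"
        by (rule ennreal_mult'[symmetric]) simp
      then show "ennreal (norm (taylor_coeff f k)) * ennreal (K * M * (real k + 1) powr (- (2 / p)))
          = ennreal ((K * M) * ((real k + 1) powr (- (2 / p)) * norm (taylor_coeff f k)))"
        by (simp only: mult_ac)
    qed
    also have "\<dots> = ennreal (\<Sum>k. (K * M) * ((real k + 1) powr (- (2 / p)) * norm (taylor_coeff f k)))"
      using K M C(2)[OF f] by (intro suminf_ennreal2 summable_mult) auto
    also have "(\<Sum>k. (K * M) * ((real k + 1) powr (- (2 / p)) * norm (taylor_coeff f k)))
        = (K * M) * (\<Sum>k. (real k + 1) powr (- (2 / p)) * norm (taylor_coeff f k))"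
      by (rule suminf_mult[OF C(2)[OF f]])
    also have "ennreal \<dots> \<le> ennreal ((K * M) * (C * bergman_norm p f))"
      using K M by (intro ennreal_leI mult_left_mono C(3)[OF f]) auto
    finally show ?thesis by (simp add: mult.assoc)
  qed
  show thesis
  proof (rule that[of "K * M * C"])
    show "K * M * C > 0" using K M C by simp
    fix f assume f: "f \<in> bergman_space p"
    then have hol: "f holomorphic_on ball 0 1" by (simp add: bergman_space_def)
    show "(\<integral>\<^sup>+t. (\<Sum>k. ennreal (norm (taylor_coeff f k) * t ^ k)) \<partial>\<nu>) \<le> ennreal (K * M * C * bergman_norm p f)"
      by (rule maj[OF f])
    have "(\<integral>\<^sup>+t. ennreal (norm (f (of_real t))) \<partial>\<nu>) \<le> (\<integral>\<^sup>+t. (\<Sum>k. ennreal (norm (taylor_coeff f k) * t ^ k)) \<partial>\<nu>)"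
    proof (intro nn_integral_mono)
      fix t assume "t \<in> space \<nu>"
      then have t: "0 \<le> t" "t < 1" by (auto simp: space_unit_measure[OF \<nu>])
      have sm: "summable (\<lambda>k. norm (taylor_coeff f k) * t ^ k)"
        by (rule summable_norm_taylor_coeff[OF hol t])
      have "f (of_real t) = (\<Sum>k. taylor_coeff f k * of_real t ^ k)"
        using t by (intro sums_unique taylor_coeff_sums hol) auto
      then have "norm (f (of_real t)) \<le> (\<Sum>k. norm (taylor_coeff f k) * t ^ k)"
        using sm t summable_norm[of "\<lambda>k. taylor_coeff f k * of_real t ^ k"]
        by (simp add: norm_mult norm_power)
      then show "ennreal (norm (f (of_real t))) \<le> (\<Sum>k. ennreal (norm (taylor_coeff f k) * t ^ k))"
        using t sm by (subst suminf_ennreal2) (auto intro!: ennreal_leI)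
    qed
    also note maj[OF f]
    finally show "(\<integral>\<^sup>+t. ennreal (norm (f (of_real t))) \<partial>\<nu>) \<le> ennreal (K * M * C * bergman_norm p f)" .
  qed
qed

section \<open>The operator as an integral transform\<close>

definition kernel_coeff :: "real \<Rightarrow> nat \<Rightarrow> real" where
  "kernel_coeff \<alpha> n = Gamma (real n + 1 + \<alpha>) / (Gamma (real n + 1) * Gamma (\<alpha> + 1))"

lemma kernel_coeff_pos: "\<alpha> > -1 \<Longrightarrow> kernel_coeff \<alpha> n > 0"
  unfolding kernel_coeff_def by (intro divide_pos_pos mult_pos_pos Gamma_real_pos) auto

text \<open>
  The Gamma quotient equals \<open>pochhammer (\<alpha> + 1) n / fact n\<close>, so this is the binomial series.
\<close>

lemma kernel_sums:
  fixes w :: complex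
  assumes \<alpha>: "\<alpha> > -1" and w: "norm w < 1"
  shows "(\<lambda>n. of_real (kernel_coeff \<alpha> n) * w ^ n) sums ((1 - w) powr of_real (- (\<alpha> + 1)))"
proof -
  have "(\<lambda>n. (of_real (- (\<alpha> + 1)) gchoose n) * (- w) ^ n) sums ((1 + (- w)) powr of_real (- (\<alpha> + 1)))"
    using w by (intro gen_binomial_complex) simp
  moreover have "(of_real (- (\<alpha> + 1)) gchoose n) * (- w) ^ n = of_real (kernel_coeff \<alpha> n) * w ^ n" for n
  proof -
    have ni: "\<alpha> + 1 \<notin> \<int>\<^sub>\<le>\<^sub>0" using \<alpha> by (auto elim!: nonpos_Ints_cases)
    have "kernel_coeff \<alpha> n = pochhammer (\<alpha> + 1) n / fact n"
      using Gamma_fact[of n, where 'a = real] pochhammer_Gamma[OF ni, of n]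
      by (simp add: kernel_coeff_def add_ac)
    then have "complex_of_real (kernel_coeff \<alpha> n) = pochhammer (of_real (\<alpha> + 1)) n / fact n"
      by (simp only: of_real_divide pochhammer_of_real[symmetric] of_real_fact)
    moreover have "(complex_of_real (- (\<alpha> + 1)) gchoose n)
        = (-1) ^ n * (pochhammer (of_real (\<alpha> + 1)) n / fact n)"
      by (simp only: gbinomial_pochhammer of_real_minus minus_minus times_divide_eq_right)
    moreover have "(-1) ^ n * (- w) ^ n = w ^ n" by (simp flip: power_mult_distrib)
    ultimately show ?thesis by (simp add: mult_ac)
  qed
  ultimately show ?thesis by simp
qed

lemma finite_measure_of_tail:
  assumes "borel_measure_on_unit \<mu>"
    and "\<And>t. 0 \<le> t \<Longrightarrow> t < 1 \<Longrightarrow> emeasure \<mu> {t..<1} \<le> ennreal (M * (1 - t) powr s)"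
  shows "finite_measure \<mu>"
proof (rule finite_measureI)
  have "emeasure \<mu> {0..<1} \<le> ennreal (M * (1 - 0) powr s)" by (rule assms(2)) auto
  then show "emeasure \<mu> (space \<mu>) \<noteq> \<infinity>"
    by (auto simp: space_unit_measure[OF assms(1)] top_unique)
qed

text \<open>
  Two exchanges of sum and integral: in the inner series the majorant of the Carleson embedding dominates, in
  the outer series the terms are dominated by those of the binomial series at \<open>|z|\<close> times \<open>|f t|\<close>, because
  \<open>0 \<le> t < 1\<close>.
\<close>

lemma hilbert_op_integral_representation:
  fixes p \<alpha> :: real
  assumes p: "0 < p" "p \<le> 1" and \<alpha>: "\<alpha> > -1" and \<mu>: "borel_measure_on_unit \<mu>" and M: "M > 0"
    and tail: "\<And>t. 0 \<le> t \<Longrightarrow> t < 1 \<Longrightarrow> emeasure \<mu> {t..<1} \<le> ennreal (M * (1 - t) powr (2 / p))"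
    and f: "f \<in> bergman_space p"
  shows "hilbert_op_defined \<mu> \<alpha> f"
    and "\<And>z. norm z < 1 \<Longrightarrow> hilbert_op \<mu> \<alpha> f z
          = (LINT t|\<mu>. f (of_real t) * (1 - of_real t * z) powr of_real (- (\<alpha> + 1)))"
proof -
  interpret finite_measure \<mu> by (rule finite_measure_of_tail[OF \<mu> tail])
  have hol: "f holomorphic_on ball 0 1" using f by (simp add: bergman_space_def)
  obtain C where "C > 0" and CC: "\<And>f. f \<in> bergman_space p \<Longrightarrow>
       (\<integral>\<^sup>+t. (\<Sum>k. ennreal (norm (taylor_coeff f k) * t ^ k)) \<partial>\<mu>) \<le> ennreal (C * bergman_norm p f)"
    "\<And>f. f \<in> bergman_space p \<Longrightarrow>
       (\<integral>\<^sup>+t. ennreal (norm (f (of_real t))) \<partial>\<mu>) \<le> ennreal (C * bergman_norm p f)"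
    using carleson_embedding[OF p \<mu> M tail] by blast
  note C = CC[OF f]
  have fm [measurable]: "(\<lambda>t. f (of_real t)) \<in> borel_measurable \<mu>"
    by (intro borel_measurable_unit_measure[OF \<mu>] continuous_on_real_trace hol)
  have fint: "integrable \<mu> (\<lambda>t. f (of_real t))"
    using C(2) by (intro integrableI_bounded fm) (auto simp: less_top[symmetric] top_unique)
  have tm [measurable]: "(\<lambda>t. t) \<in> borel_measurable \<mu>"
    by (intro borel_measurable_unit_measure[OF \<mu>] continuous_intros)
  have t01: "0 \<le> t" "t < 1" if "t \<in> space \<mu>" for t
    using that by (auto simp: space_unit_measure[OF \<mu>])
  have t1: "t \<le> 1" if "t \<in> space \<mu>" for t using t01(2)[OF that] by simp
  have tint: "integrable \<mu> (\<lambda>t. t ^ k)" for k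
    by (rule integrable_const_bound[where B=1])
      (auto simp: t01 t1 intro!: AE_I2 power_le_one)
  have mom: "summable (\<lambda>k. norm (taylor_coeff f k) * moment \<mu> k)"
  proof (rule summable_suminf_not_top)
    show "0 \<le> norm (taylor_coeff f k) * moment \<mu> k" for k
      unfolding moment_def by (intro mult_nonneg_nonneg integral_nonneg_AE AE_I2) (auto simp: t01)
    have "ennreal (norm (taylor_coeff f k) * moment \<mu> k)
        = (\<integral>\<^sup>+t. ennreal (norm (taylor_coeff f k) * t ^ k) \<partial>\<mu>)" for k
      using nn_integral_eq_integral[OF integrable_mult_right[OF tint[of k], of "norm (taylor_coeff f k)"]] t01
      by (simp add: moment_def AE_I2)
    then have "(\<Sum>k. ennreal (norm (taylor_coeff f k) * moment \<mu> k))
        = (\<integral>\<^sup>+t. (\<Sum>k. ennreal (norm (taylor_coeff f k) * t ^ k)) \<partial>\<mu>)"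
      by (subst nn_integral_suminf) auto
    then show "(\<Sum>k. ennreal (norm (taylor_coeff f k) * moment \<mu> k)) \<noteq> top"
      using C(1) by (auto simp: top_unique)
  qed
  have inner: "(\<lambda>k. of_real (hankel_entry \<mu> n k) * taylor_coeff f k) sums (LINT t|\<mu>. of_real t ^ n * f (of_real t))" for n
  proof -
    define h where "h k t = taylor_coeff f k * of_real t ^ (n + k)" for k and t :: real
    have hint: "integrable \<mu> (h k)" for k
      unfolding h_def of_real_power[symmetric] by (intro integrable_mult_right integrable_of_real tint)
    have nh: "norm (h k t) \<le> norm (taylor_coeff f k) * t ^ k" if "t \<in> space \<mu>" for k t
      using t01[OF that]
      by (auto simp: h_def norm_mult norm_power power_add intro!: mult_left_mono mult_left_le_one_le power_le_one)
    have "(\<lambda>k. integral\<^sup>L \<mu> (h k)) sums (LINT t|\<mu>. (\<Sum>k. h k t))"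
    proof (rule sums_integral[OF hint])
      show "AE t in \<mu>. summable (\<lambda>k. norm (h k t))"
      proof (rule AE_I2)
        fix t assume t: "t \<in> space \<mu>"
        show "summable (\<lambda>k. norm (h k t))"
          by (rule summable_comparison_test'[OF summable_norm_taylor_coeff[OF hol t01[OF t]]])
            (use nh[OF t] in simp)
      qed
      show "summable (\<lambda>k. LINT t|\<mu>. norm (h k t))"
      proof (rule summable_comparison_test'[OF mom])
        fix k
        have "(LINT t|\<mu>. norm (h k t)) \<le> (LINT t|\<mu>. norm (taylor_coeff f k) * t ^ k)"
          by (intro integral_mono integrable_norm hint integrable_mult_right tint nh)
        then show "norm (LINT t|\<mu>. norm (h k t)) \<le> norm (taylor_coeff f k) * moment \<mu> k"
          by (simp add: moment_def)
      qed
    qed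
    moreover have "integral\<^sup>L \<mu> (h k) = of_real (hankel_entry \<mu> n k) * taylor_coeff f k" for k
      unfolding h_def of_real_power[symmetric]
      by (simp add: hankel_entry_def moment_def mult.commute del: of_real_power)
    moreover have "(LINT t|\<mu>. (\<Sum>k. h k t)) = (LINT t|\<mu>. of_real t ^ n * f (of_real t))"
    proof (rule Bochner_Integration.integral_cong[OF refl])
      fix t assume t: "t \<in> space \<mu>"
      have "(\<lambda>k. of_real t ^ n * (taylor_coeff f k * of_real t ^ k)) sums (of_real t ^ n * f (of_real t))"
        using t01[OF t] by (intro sums_mult taylor_coeff_sums hol) auto
      then show "(\<Sum>k. h k t) = of_real t ^ n * f (of_real t)"
        by (simp add: h_def power_add sums_iff mult_ac)
    qed
    ultimately show ?thesis by simp
  qed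
  have outer: "(\<lambda>n. hilbert_coeff \<mu> \<alpha> f n * z ^ n) sums
      (LINT t|\<mu>. f (of_real t) * (1 - of_real t * z) powr of_real (- (\<alpha> + 1)))" if z: "norm z < 1" for z
  proof -
    define h where "h n t = of_real (kernel_coeff \<alpha> n) * z ^ n * (of_real t ^ n * f (of_real t))" for n and t :: real
    have fint': "integrable \<mu> (\<lambda>t. of_real t ^ n * f (of_real t))" for n
    proof (rule Bochner_Integration.integrable_bound[OF fint])
      show "AE t in \<mu>. norm (of_real t ^ n * f (of_real t)) \<le> norm (f (of_real t))"
        by (auto simp: norm_mult norm_power t01 t1 intro!: AE_I2 mult_left_le_one_le power_le_one)
    qed measurable
    have hint: "integrable \<mu> (h n)" for n
      unfolding h_def by (intro integrable_mult_right fint')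
    have nh: "norm (h n t) \<le> kernel_coeff \<alpha> n * norm z ^ n * norm (f (of_real t))" if "t \<in> space \<mu>" for n t
    proof -
      have "norm (h n t) = kernel_coeff \<alpha> n * norm z ^ n * (t ^ n * norm (f (of_real t)))"
        using kernel_coeff_pos[OF \<alpha>, of n] t01[OF that]
        by (simp only: h_def norm_mult norm_power norm_of_real abs_of_pos abs_of_nonneg)
      also have "\<dots> \<le> kernel_coeff \<alpha> n * norm z ^ n * (1 * norm (f (of_real t)))"
        using kernel_coeff_pos[OF \<alpha>, of n] t01[OF that]
        by (intro mult_left_mono mult_right_mono power_le_one) (auto simp: less_imp_le)
      finally show ?thesis by simp
    qed
    have ks: "summable (\<lambda>n. kernel_coeff \<alpha> n * norm z ^ n)"
    proof -
      have "summable (\<lambda>n. complex_of_real (kernel_coeff \<alpha> n) * of_real (norm z) ^ n)"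
        using z by (intro sums_summable[OF kernel_sums[OF \<alpha>]]) simp
      then have "summable (\<lambda>n. complex_of_real (kernel_coeff \<alpha> n * norm z ^ n))"
        by (simp only: of_real_mult of_real_power)
      then show ?thesis by (simp only: summable_complex_of_real)
    qed
    have "(\<lambda>n. integral\<^sup>L \<mu> (h n)) sums (LINT t|\<mu>. (\<Sum>n. h n t))"
    proof (rule sums_integral[OF hint])
      show "AE t in \<mu>. summable (\<lambda>n. norm (h n t))"
      proof (rule AE_I2)
        fix t assume t: "t \<in> space \<mu>"
        show "summable (\<lambda>n. norm (h n t))"
          by (rule summable_comparison_test'[OF summable_mult2[OF ks, of "norm (f (of_real t))"]])
            (use nh[OF t] in simp)
      qed
      show "summable (\<lambda>n. LINT t|\<mu>. norm (h n t))"
      proof (rule summable_comparison_test'[OF summable_mult2[OF ks, of "LINT t|\<mu>. norm (f (of_real t))"]])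
        fix n
        have "(LINT t|\<mu>. norm (h n t)) \<le> (LINT t|\<mu>. kernel_coeff \<alpha> n * norm z ^ n * norm (f (of_real t)))"
          by (intro integral_mono integrable_norm hint integrable_mult_right fint nh)
        then show "norm (LINT t|\<mu>. norm (h n t)) \<le> kernel_coeff \<alpha> n * norm z ^ n * (LINT t|\<mu>. norm (f (of_real t)))"
          by simp
      qed
    qed
    moreover have "integral\<^sup>L \<mu> (h n) = hilbert_coeff \<mu> \<alpha> f n * z ^ n" for n
      unfolding h_def hilbert_coeff_def kernel_coeff_def sums_unique[OF inner[of n], symmetric]
        integral_mult_right_zero
      by (simp only: mult_ac)
    moreover have "(LINT t|\<mu>. (\<Sum>n. h n t)) = (LINT t|\<mu>. f (of_real t) * (1 - of_real t * z) powr of_real (- (\<alpha> + 1)))"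
    proof (rule Bochner_Integration.integral_cong[OF refl])
      fix t assume t: "t \<in> space \<mu>"
      have "norm (of_real t * z) < 1"
        using t01[OF t] z mult_le_one[of t "norm z"] mult_left_le_one_le[of "norm z" t] by (auto simp: norm_mult)
      then have "(\<lambda>n. f (of_real t) * (of_real (kernel_coeff \<alpha> n) * (of_real t * z) ^ n)) sums
          (f (of_real t) * (1 - of_real t * z) powr of_real (- (\<alpha> + 1)))"
        by (intro sums_mult kernel_sums[OF \<alpha>])
      moreover have "(\<lambda>n. f (of_real t) * (of_real (kernel_coeff \<alpha> n) * (of_real t * z) ^ n)) = (\<lambda>n. h n t)"
        by (simp only: h_def power_mult_distrib mult_ac)
      ultimately show "(\<Sum>n. h n t) = f (of_real t) * (1 - of_real t * z) powr of_real (- (\<alpha> + 1))"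
        by (simp only: sums_iff)
    qed
    ultimately show ?thesis by simp
  qed
  show "hilbert_op_defined \<mu> \<alpha> f"
    unfolding hilbert_op_defined_def using sums_summable[OF inner] sums_summable[OF outer] by simp
  show "hilbert_op \<mu> \<alpha> f z = (LINT t|\<mu>. f (of_real t) * (1 - of_real t * z) powr of_real (- (\<alpha> + 1)))"
    if "norm z < 1" for z
    unfolding hilbert_op_def using outer[OF that] by (rule sums_unique[symmetric])
qed

lemma hilbert_op_holomorphic:
  assumes "hilbert_op_defined \<mu> \<alpha> f"
  shows "hilbert_op \<mu> \<alpha> f holomorphic_on ball 0 1"
proof (rule power_series_holomorphic)
  fix z :: complex assume "z \<in> ball 0 1"
  then show "(\<lambda>n. hilbert_coeff \<mu> \<alpha> f n * (z - 0) ^ n) sums hilbert_op \<mu> \<alpha> f z"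
    using assms by (auto simp: hilbert_op_defined_def hilbert_op_def intro!: summable_sums)
qed

section \<open>Area integrals of the kernel, and a power mean inequality\<close>

lemma emeasure_disc_area_le_ball:
  assumes "S \<subseteq> ball 0 1" "S \<in> sets borel" "S \<subseteq> ball c r" "r \<ge> 0"
  shows "emeasure disc_area S \<le> ennreal (r\<^sup>2)"
proof -
  have "emeasure disc_area S = ennreal (1 / pi) * emeasure lborel S"
    using assms by (simp add: disc_area_def emeasure_restrict_space)
  also have "\<dots> \<le> ennreal (1 / pi) * emeasure lborel (ball c r)"
    using assms by (intro mult_left_mono emeasure_mono) auto
  also have "\<dots> = ennreal (r\<^sup>2)"
    using assms by (simp add: emeasure_ball eval_unit_ball_vol flip: ennreal_mult')
  finally show ?thesis .
qed

text \<open>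
  For \<open>a \<ge> 1/2\<close> the set lies in a disc of radius \<open>r / a \<le> 2 r\<close> around \<open>1 / a\<close>. For \<open>a < 1/2\<close> it is empty
  unless \<open>r > 1/2\<close>, and then \<open>4 r\<^sup>2\<close> exceeds the total area.
\<close>

lemma emeasure_kernel_sublevel_le:
  fixes a r :: real
  assumes a: "0 \<le> a" "a < 1" and r: "r > 0"
  defines "S \<equiv> {z \<in> ball 0 1. norm (1 - of_real a * z) < r}"
  shows "emeasure disc_area S \<le> ennreal (4 * r\<^sup>2)"
proof -
  have S: "S \<subseteq> ball 0 1" "S \<in> sets borel"
  proof -
    have "S = ball 0 1 \<inter> {z. norm (1 - of_real a * z) < r}" by (auto simp: S_def)
    moreover have "open {z::complex. norm (1 - of_real a * z) < r}"
      by (intro open_Collect_less continuous_intros)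
    ultimately show "S \<in> sets borel" by auto
  qed (auto simp: S_def)
  show ?thesis
  proof (cases "a \<ge> 1 / 2")
    case True
    have "S \<subseteq> ball (of_real (1 / a)) (r / a)"
    proof
      fix z assume z: "z \<in> S"
      have "of_real (1 / a) - z = (1 - of_real a * z) / of_real a"
        using True by (simp add: field_simps)
      then have "norm (of_real (1 / a) - z) = norm (1 - of_real a * z) / a"
        using True by (simp only: norm_divide norm_of_real abs_of_nonneg a)
      also have "\<dots> < r / a" using z True by (intro divide_strict_right_mono) (auto simp: S_def)
      finally show "z \<in> ball (of_real (1 / a)) (r / a)" by (simp only: mem_ball dist_norm)
    qed
    then have "emeasure disc_area S \<le> ennreal ((r / a)\<^sup>2)"
      using True r by (intro emeasure_disc_area_le_ball S) auto
    also have "\<dots> \<le> ennreal ((2 * r)\<^sup>2)"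
      using True r by (intro ennreal_leI power_mono) (auto simp: field_simps)
    finally show ?thesis by (simp add: power2_eq_square)
  next
    case False
    show ?thesis
    proof (cases "S = {}")
      case nonempty: False
      then obtain z :: complex where z: "norm z < 1" "norm (1 - of_real a * z) < r" by (auto simp: S_def)
      have "1 - a \<le> 1 - norm (of_real a * z)"
        using a z by (simp add: norm_mult mult_left_le)
      also have "\<dots> \<le> norm (1 - of_real a * z)"
        using norm_triangle_ineq2[of 1 "of_real a * z"] by simp
      finally have "1 / 2 < r" using z False by linarith
      then have "1 / 2 * (1 / 2) \<le> r * r" by (intro mult_mono) auto
      moreover have "emeasure disc_area S \<le> 1"
        using emeasure_mono[of S "ball 0 1" disc_area] S emeasure_disc_area_UNIV
        by (simp add: sets_disc_area sets_restrict_space_iff)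
      ultimately show ?thesis
        by (auto simp: power2_eq_square intro: order_trans[where y="ennreal 1"] simp flip: ennreal_1)
    qed simp
  qed
qed

text \<open>
  Decompose the disc according to the dyadic size \<open>2 ^ (-i)\<close> of \<open>|1 - a z|\<close>, which lies between \<open>1 - a\<close> and 2.
  The level \<open>i\<close> contributes at most \<open>2 powr (c i)\<close> times the area of a sublevel set, which is of order
  \<open>4 ^ (-i)\<close>, and only levels with \<open>2 ^ (-i)\<close> not much smaller than \<open>1 - a\<close> occur. The three following estimates
  sum the geometric progression for ratio below, equal to and above 1.
\<close>

lemma integral_kernel_le_dyadic_sum:
  fixes a c :: real
  assumes a: "0 \<le> a" "a < 1" and c: "c > 0"
  shows "(\<integral>\<^sup>+z. ennreal (norm (1 - of_real a * z) powr (- c)) \<partial>disc_area)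
       \<le> ennreal (16 * (\<Sum>i<nat \<lceil>1 + log 2 (1 / (1 - a))\<rceil>. (2 powr (c - 2)) ^ i))"
proof -
  define N where "N = nat \<lceil>1 + log 2 (1 / (1 - a))\<rceil>"
  define S :: "nat \<Rightarrow> complex set" where "S i = {z \<in> ball 0 1. norm (1 - of_real a * z) < 2 * (1 / 2) ^ i}" for i
  have Sm: "S i \<in> sets disc_area" for i
  proof -
    have "S i = ball 0 1 \<inter> {z. norm (1 - of_real a * z) < 2 * (1 / 2) ^ i}" by (auto simp: S_def)
    moreover have "open {z::complex. norm (1 - of_real a * z) < 2 * (1 / 2) ^ i}"
      by (intro open_Collect_less continuous_intros)
    ultimately show ?thesis by (auto simp: sets_disc_area sets_restrict_space_iff)
  qed
  have pt: "ennreal (norm (1 - of_real a * z) powr (- c)) \<le> (\<Sum>i<N. ennreal ((2 powr c) ^ i) * indicator (S i) z)"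
    if z: "z \<in> space disc_area" for z
  proof -
    have z1: "norm z < 1" using z by simp
    define x where "x = norm (1 - of_real a * z)"
    have az: "norm (of_real a * z) \<le> a" "norm (of_real a * z) < 1"
      using a z1 by (auto simp: norm_mult mult_left_le intro: le_less_trans[OF mult_left_le])
    have "1 - a \<le> 1 - norm (of_real a * z)" using az by simp
    also have "\<dots> \<le> x" unfolding x_def using norm_triangle_ineq2[of 1 "of_real a * z"] by simp
    finally have x1: "1 - a \<le> x" .
    then have x0: "x > 0" using a by simp
    have "x \<le> 1 + norm (of_real a * z)"
      unfolding x_def using norm_triangle_ineq4[of 1 "of_real a * z"] by simp
    then have x2: "x < 2" using az by linarith
    define i where "i = nat \<lceil>- log 2 x\<rceil>"
    have l1: "- log 2 x > -1" using x0 x2 log_less_cancel_iff[of 2 x 2] by simp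
    have i: "- log 2 x \<le> real i" "real i < - log 2 x + 1" using l1 unfolding i_def by linarith+
    have xlog: "2 powr (log 2 x) = x" using x0 by simp
    have lower: "2 powr (- real i) \<le> x"
      using i(1) powr_mono[of "- real i" "log 2 x" 2] by (simp add: xlog)
    have upper: "x < 2 * (1 / 2) ^ i"
    proof -
      have "log 2 x < 1 - real i" using i(2) by simp
      then have "x < 2 powr (1 - real i)"
        using powr_less_mono[of "log 2 x" "1 - real i" 2] by (simp add: xlog)
      also have "\<dots> = 2 * (1 / 2) ^ i" by (simp add: powr_diff powr_realpow power_divide)
      finally show ?thesis .
    qed
    have "log 2 (1 / x) \<le> log 2 (1 / (1 - a))"
      using x1 x0 a by (subst log_le_cancel_iff) (auto simp: field_simps)
    then have "- log 2 x \<le> log 2 (1 / (1 - a))" using x0 by (simp add: log_divide)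
    then have iN: "i < N" using i(2) unfolding N_def by linarith
    have "x powr (- c) \<le> (2 powr (- real i)) powr (- c)"
      using lower c by (intro powr_mono2') auto
    also have "\<dots> = (2 powr c) ^ i" by (simp add: powr_powr powr_power mult.commute)
    finally have "ennreal (x powr (- c)) \<le> ennreal ((2 powr c) ^ i) * indicator (S i) z"
      using upper z1 by (auto simp: S_def x_def intro!: ennreal_leI)
    also have "\<dots> \<le> (\<Sum>i<N. ennreal ((2 powr c) ^ i) * indicator (S i) z)"
      using iN member_le_sum[of i "{..<N}" "\<lambda>i. ennreal ((2 powr c) ^ i) * indicator (S i) z"] by auto
    finally show ?thesis by (simp only: x_def)
  qed
  have "(\<integral>\<^sup>+z. ennreal (norm (1 - of_real a * z) powr (- c)) \<partial>disc_area)
      \<le> (\<integral>\<^sup>+z. (\<Sum>i<N. ennreal ((2 powr c) ^ i) * indicator (S i) z) \<partial>disc_area)"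
    by (intro nn_integral_mono pt)
  also have "\<dots> = (\<Sum>i<N. ennreal ((2 powr c) ^ i) * emeasure disc_area (S i))"
    using Sm by (subst nn_integral_sum) (auto simp: nn_integral_cmult_indicator)
  also have "\<dots> \<le> (\<Sum>i<N. ennreal (16 * (2 powr (c - 2)) ^ i))"
  proof (intro sum_mono)
    fix i
    have "ennreal ((2 powr c) ^ i) * emeasure disc_area (S i) \<le> ennreal ((2 powr c) ^ i) * ennreal (4 * (2 * (1 / 2) ^ i)\<^sup>2)"
      unfolding S_def by (intro mult_left_mono emeasure_kernel_sublevel_le a) auto
    also have "\<dots> = ennreal ((2 powr c) ^ i * (4 * (2 * (1 / 2) ^ i)\<^sup>2))"
      by (rule ennreal_mult'[symmetric]) simp
    also have "(2 powr c) ^ i * (4 * (2 * (1 / 2) ^ i)\<^sup>2) = 16 * (2 powr (c - 2)) ^ i"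
    proof -
      have "(2 ^ i)\<^sup>2 = (4 :: real) ^ i"
        by (simp add: power2_eq_square flip: power_mult_distrib)
      then have "(2 * (1 / 2) ^ i)\<^sup>2 = 4 * (1 / 4 :: real) ^ i"
        by (simp add: power_mult_distrib power_divide)
      moreover have "(2 powr (c - 2)) ^ i = (2 powr c) ^ i * (1 / 4 :: real) ^ i"
        by (simp add: powr_diff power_divide)
      ultimately show ?thesis by simp
    qed
    finally show "ennreal ((2 powr c) ^ i) * emeasure disc_area (S i) \<le> ennreal (16 * (2 powr (c - 2)) ^ i)" .
  qed
  also have "\<dots> = ennreal (16 * (\<Sum>i<N. (2 powr (c - 2)) ^ i))"
    by (simp add: sum_distrib_left)
  finally show ?thesis by (simp add: N_def)
qed

lemma integral_kernel_subcritical: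
  fixes c :: real
  assumes c: "0 < c" "c < 2" and a: "0 \<le> a" "a < 1"
  shows "(\<integral>\<^sup>+z. ennreal (norm (1 - of_real a * z) powr (- c)) \<partial>disc_area)
       \<le> ennreal (16 / (1 - 2 powr (c - 2)))"
proof -
  let ?r = "2 powr (c - 2) :: real"
  have r: "0 < ?r" "?r < 1" using c powr_less_cancel_iff[of 2 "c - 2" 0] by auto
  have "(\<Sum>i<N. ?r ^ i) \<le> 1 / (1 - ?r)" for N
    using r sum_le_suminf[of "\<lambda>i. ?r ^ i" "{..<N}"] by (simp add: suminf_geometric summable_geometric)
  then have "16 * (\<Sum>i<nat \<lceil>1 + log 2 (1 / (1 - a))\<rceil>. ?r ^ i) \<le> 16 * (1 / (1 - ?r))"
    by (rule mult_left_mono) simp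
  then show ?thesis
    by (intro order_trans[OF integral_kernel_le_dyadic_sum[OF a c(1)]] ennreal_leI) simp
qed

lemma integral_kernel_critical:
  assumes a: "0 \<le> a" "a < 1"
  shows "(\<integral>\<^sup>+z. ennreal (norm (1 - of_real a * z) powr (- 2)) \<partial>disc_area)
       \<le> ennreal (32 * ln (exp 1 / (1 - a)))"
proof -
  define L where "L = ln (1 / (1 - a))"
  have L0: "0 \<le> L" using a by (simp add: L_def)
  have "log 2 (1 / (1 - a)) = L / ln 2" by (simp add: L_def log_def)
  also have "\<dots> \<le> L / (1 / 2)"
    using L0 ln2_ge_two_thirds by (intro divide_left_mono) auto
  finally have l: "log 2 (1 / (1 - a)) \<le> 2 * L" by simp
  have l0: "0 \<le> log 2 (1 / (1 - a))" using a by simp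
  have "real (nat \<lceil>1 + log 2 (1 / (1 - a))\<rceil>) \<le> 2 + log 2 (1 / (1 - a))" using l0 by linarith
  also have "\<dots> \<le> 2 * (1 + L)" using l by simp
  also have "1 + L = ln (exp 1 / (1 - a))" using a by (simp add: L_def ln_div)
  finally show ?thesis
    by (intro order_trans[OF integral_kernel_le_dyadic_sum[OF a]] ennreal_leI) auto
qed

lemma integral_kernel_supercritical:
  fixes c :: real
  assumes c: "c > 2" and a: "0 \<le> a" "a < 1"
  shows "(\<integral>\<^sup>+z. ennreal (norm (1 - of_real a * z) powr (- c)) \<partial>disc_area)
       \<le> ennreal (16 * 4 powr (c - 2) / (2 powr (c - 2) - 1) * (1 - a) powr (2 - c))"
proof -
  let ?r = "2 powr (c - 2) :: real"
  define N where "N = nat \<lceil>1 + log 2 (1 / (1 - a))\<rceil>"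
  have r: "?r > 1" using c powr_less_cancel_iff[of 2 0 "c - 2"] by auto
  have l0: "0 \<le> log 2 (1 / (1 - a))" using a by simp
  have N: "real N \<le> 2 + log 2 (1 / (1 - a))" unfolding N_def using l0 by linarith
  have "?r ^ N = 2 powr ((c - 2) * real N)" by (simp add: powr_power mult.commute)
  also have "\<dots> \<le> 2 powr ((c - 2) * (2 + log 2 (1 / (1 - a))))"
    using N c by (intro powr_mono mult_left_mono) auto
  also have "\<dots> = (2 powr (2 + log 2 (1 / (1 - a)))) powr (c - 2)"
    by (simp add: powr_powr mult.commute)
  also have "2 powr (2 + log 2 (1 / (1 - a))) = 4 / (1 - a)"
    using a by (simp add: powr_add)
  also have "(4 / (1 - a)) powr (c - 2) = 4 powr (c - 2) * (1 - a) powr (2 - c)"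
    using a powr_minus[of "1 - a" "c - 2"] by (simp add: powr_divide inverse_eq_divide)
  finally have rN: "?r ^ N \<le> 4 powr (c - 2) * (1 - a) powr (2 - c)" .
  have "(\<Sum>i<N. ?r ^ i) = (?r ^ N - 1) / (?r - 1)"
    using r by (intro geometric_sum) auto
  also have "\<dots> \<le> (4 powr (c - 2) * (1 - a) powr (2 - c)) / (?r - 1)"
    using r rN by (intro divide_right_mono) auto
  finally have "16 * (\<Sum>i<N. ?r ^ i) \<le> 16 * ((4 powr (c - 2) * (1 - a) powr (2 - c)) / (?r - 1))"
    by simp
  then show ?thesis
    using c by (intro order_trans[OF integral_kernel_le_dyadic_sum[OF a]] ennreal_leI) (auto simp: N_def)
qed

text \<open>
  Hoelder's inequality up to a constant: Young's inequality in the crude form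
  \<open>x \<le> s + s powr (1 - q) * x powr q\<close> is integrated and \<open>s\<close> is chosen so that both terms agree.
\<close>

lemma (in finite_measure) power_mean_inequality:
  fixes x :: "'a \<Rightarrow> real"
  assumes q: "1 < q" and x: "x \<in> borel_measurable M" "\<And>t. t \<in> space M \<Longrightarrow> 0 \<le> x t"
    and int: "integrable M (\<lambda>t. x t powr q)"
  shows "integrable M x"
    and "(LINT t|M. x t) powr q
       \<le> 2 powr q * measure M (space M) powr (q - 1) * (LINT t|M. x t powr q)"
proof -
  have young: "x t \<le> s + s powr (1 - q) * x t powr q" if t: "t \<in> space M" and s: "s > 0" for s t
  proof (cases "x t \<le> s")
    case False
    then have xt: "x t > 0" using s by simp
    have "1 \<le> (x t / s) powr (q - 1)"
      using False s q by (intro ge_one_powr_ge_zero) auto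
    then have "x t * 1 \<le> x t * (x t / s) powr (q - 1)"
      using xt by (intro mult_left_mono) auto
    also have "\<dots> = s powr (1 - q) * x t powr q"
      using xt s powr_add[of "x t" 1 "q - 1"] powr_minus[of s "q - 1"]
      by (simp add: powr_divide inverse_eq_divide)
    finally show ?thesis using s by simp
  next
    case True
    moreover have "0 \<le> s powr (1 - q) * x t powr q" by simp
    ultimately show ?thesis by linarith
  qed
  let ?m = "measure M (space M)" and ?J = "LINT t|M. x t powr q" and ?I = "LINT t|M. x t"
  have bint: "integrable M (\<lambda>t. s + s powr (1 - q) * x t powr q)" for s
    using int by (intro Bochner_Integration.integrable_add integrable_mult_right) auto
  show xint: "integrable M x"
    using young[where s=1] x(2)
    by (intro Bochner_Integration.integrable_bound[OF bint[of 1] x(1)] AE_I2) (auto simp: abs_of_nonneg)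
  have I0: "0 \<le> ?I" by (intro integral_nonneg_AE AE_I2 x(2))
  have J0: "0 \<le> ?J" by (intro integral_nonneg_AE AE_I2) simp
  have bound: "?I \<le> s * ?m + s powr (1 - q) * ?J" if "s > 0" for s
  proof -
    have "?I \<le> (LINT t|M. s + s powr (1 - q) * x t powr q)"
      by (intro integral_mono xint bint young that)
    also have "\<dots> = s * ?m + s powr (1 - q) * ?J"
      using int by simp
    finally show ?thesis .
  qed
  show "?I powr q \<le> 2 powr q * ?m powr (q - 1) * ?J"
  proof (cases "?J = 0 \<or> ?m = 0")
    case True
    have "?I = 0"
    proof (cases "?J = 0")
      case True
      then have "AE t in M. x t powr q = 0"
        using integral_nonneg_eq_0_iff_AE[OF int] by simp
      then have "AE t in M. x t = 0" by auto
      then have "?I = (LINT t|M. 0)" using x(1) by (intro integral_cong_AE) auto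
      then show ?thesis by simp
    next
      case False
      with True have "?m = 0" by simp
      then have "AE t in M. False" using AE_iff_measurable[of "space M" M "\<lambda>_. False"] by (simp add: emeasure_eq_measure)
      then have "AE t in M. x t = 0" by auto
      then have "?I = (LINT t|M. 0)" using x(1) by (intro integral_cong_AE) auto
      then show ?thesis by simp
    qed
    then show ?thesis using J0 by simp
  next
    case False
    then have J: "?J > 0" and m: "?m > 0" using J0 by (auto simp: less_le)
    define s where "s = (?J / ?m) powr (1 / q)"
    have s: "s > 0" using J m by (simp add: s_def)
    have sq: "s powr q = ?J / ?m" using J m q by (simp add: s_def powr_powr)
    have "s powr (1 - q) * ?J = s * ?m"
      using s sq J m by (simp add: powr_diff)
    then have "?I \<le> 2 * (s * ?m)" using bound[OF s] by simp
    then have "?I powr q \<le> (2 * (s * ?m)) powr q"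
      using I0 q by (intro powr_mono2) auto
    also have "\<dots> = 2 powr q * (s powr q * ?m powr q)"
      using s m by (simp add: powr_mult)
    also have "s powr q * ?m powr q = ?m powr (q - 1) * ?J"
      using m by (simp add: sq powr_diff)
    finally show ?thesis by (simp add: mult.assoc)
  qed
qed

section \<open>Sufficiency: boundedness from a weighted tail condition\<close>

text \<open>
  Minkowski's inequality in the following form. With respect to \<open>d\<sigma> = |f| W d\<mu>\<close>, of mass
  \<open>m \<le> C \<parallel>f\<parallel>\<^sub>p\<close> by the Carleson embedding, \<open>|H f(z)|\<close> is at most the integral of
  \<open>x z t = |1 - t z| powr (-(\<alpha> + 1)) / W t\<close>. The power mean inequality bounds \<open>|H f(z)| powr q\<close> by a multiple of
  \<open>m powr (q - 1) \<integral> (x z t) powr q d\<sigma>(t)\<close>, and integrating in \<open>z\<close> first, the kernel hypothesis makes the inner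
  integral at most \<open>B\<close>. The total is a multiple of \<open>m powr q\<close>.
\<close>

lemma hilbert_op_bounded_of_weight:
  fixes p q \<alpha> M D B :: real and W :: "real \<Rightarrow> real"
  assumes p: "0 < p" "p \<le> 1" and q: "1 < q" and \<alpha>: "\<alpha> > -1" and \<mu>: "borel_measure_on_unit \<mu>"
    and cont: "continuous_on {0..<1} W" and pos: "\<And>t. 0 \<le> t \<Longrightarrow> t < 1 \<Longrightarrow> 0 < W t"
    and mono: "\<And>t u. 0 \<le> t \<Longrightarrow> t \<le> u \<Longrightarrow> u < 1 \<Longrightarrow> W t \<le> W u"
    and doubling: "\<And>t. 0 \<le> t \<Longrightarrow> t < 1 \<Longrightarrow> W ((1 + t) / 2) \<le> D * W t"
    and tail: "\<And>t. 0 \<le> t \<Longrightarrow> t < 1 \<Longrightarrow> emeasure \<mu> {t..<1} * ennreal (W t) \<le> ennreal (M * (1 - t) powr (2 / p))"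
    and kernel: "\<And>t. 0 \<le> t \<Longrightarrow> t < 1 \<Longrightarrow>
        (\<integral>\<^sup>+z. ennreal (norm (1 - of_real t * z) powr (- (q * (\<alpha> + 1)))) \<partial>disc_area) \<le> ennreal (B * W t powr q)"
    and M: "M > 0" and D: "D > 0" and B: "B > 0"
  shows "hilbert_op_bounded \<mu> \<alpha> p q"
proof -
  define \<nu> where "\<nu> = density \<mu> (\<lambda>t. ennreal (W t))"
  have \<nu>: "borel_measure_on_unit \<nu>" using \<mu> by (simp add: \<nu>_def borel_measure_on_unit_def)
  have s: "2 / p > 0" using p by simp
  define K where "K = D * M / (1 - 2 powr (- (2 / p)))"
  have K: "K > 0"
    unfolding K_def using D M s powr_less_cancel_iff[of 2 "- (2 / p)" 0] by (intro divide_pos_pos) auto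
  have tail\<nu>: "emeasure \<nu> {t..<1} \<le> ennreal (K * (1 - t) powr (2 / p))" if "0 \<le> t" "t < 1" for t
    unfolding \<nu>_def K_def
    by (rule tail_weighted_le[OF \<mu> cont less_imp_le[OF pos] mono doubling tail s M D that])
  obtain C where C0: "C > 0" and "\<And>f. f \<in> bergman_space p \<Longrightarrow>
       (\<integral>\<^sup>+t. (\<Sum>k. ennreal (norm (taylor_coeff f k) * t ^ k)) \<partial>\<nu>) \<le> ennreal (C * bergman_norm p f)"
    and C: "\<And>f. f \<in> bergman_space p \<Longrightarrow>
       (\<integral>\<^sup>+t. ennreal (norm (f (of_real t))) \<partial>\<nu>) \<le> ennreal (C * bergman_norm p f)"
    using carleson_embedding[OF p \<nu> K tail\<nu>] by blast
  \<comment> \<open>Since \<open>W\<close> is bounded below by \<open>W 0\<close>, the measure \<open>\<mu>\<close> itself is \<open>2/p\<close>-Carleson, so the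
    integral representation is available.\<close>
  have W0: "W 0 > 0" using pos[of 0] by simp
  have M0: "M / W 0 > 0" using M W0 by simp
  have tail\<mu>: "emeasure \<mu> {t..<1} \<le> ennreal (M / W 0 * (1 - t) powr (2 / p))" if t: "0 \<le> t" "t < 1" for t
  proof -
    have "emeasure \<mu> {t..<1} = emeasure \<mu> {t..<1} * (ennreal (W 0) * ennreal (1 / W 0))"
      using W0 by (simp flip: ennreal_mult)
    also have "\<dots> \<le> emeasure \<mu> {t..<1} * (ennreal (W t) * ennreal (1 / W 0))"
      using mono[of 0 t] t by (intro mult_left_mono mult_right_mono ennreal_leI) auto
    also have "\<dots> = emeasure \<mu> {t..<1} * ennreal (W t) * ennreal (1 / W 0)" by (simp only: mult.assoc)
    also have "\<dots> \<le> ennreal (M * (1 - t) powr (2 / p)) * ennreal (1 / W 0)"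
      by (intro mult_right_mono tail t) auto
    also have "\<dots> = ennreal (M / W 0 * (1 - t) powr (2 / p))"
      using M W0 by (simp flip: ennreal_mult)
    finally show ?thesis .
  qed
  have main: "hilbert_op_defined \<mu> \<alpha> f \<and> hilbert_op \<mu> \<alpha> f \<in> bergman_space q
      \<and> bergman_norm q (hilbert_op \<mu> \<alpha> f) \<le> (2 * B powr (1 / q) * C) * bergman_norm p f"
    if f: "f \<in> bergman_space p" for f
  proof -
    define g where "g = hilbert_op \<mu> \<alpha> f"
    have def: "hilbert_op_defined \<mu> \<alpha> f"
      by (rule hilbert_op_integral_representation(1)[OF p \<alpha> \<mu> M0 _ f]) (rule tail\<mu>)
    have rep: "g z = (LINT t|\<mu>. f (of_real t) * (1 - of_real t * z) powr of_real (- (\<alpha> + 1)))"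
      if "norm z < 1" for z
      unfolding g_def
      by (rule hilbert_op_integral_representation(2)[OF p \<alpha> \<mu> M0 _ f that]) (rule tail\<mu>)
    from def have ghol: "g holomorphic_on ball 0 1" unfolding g_def by (rule hilbert_op_holomorphic)
    have fhol: "f holomorphic_on ball 0 1" using f by (simp add: bergman_space_def)
    define N where "N = bergman_norm p f"
    have N0: "0 \<le> N" by (simp add: N_def bergman_norm_def)
    define \<sigma> where "\<sigma> = density \<nu> (\<lambda>t. ennreal (norm (f (of_real t))))"
    have [simp]: "space \<sigma> = {0..<1}" using space_unit_measure[OF \<mu>] by (simp add: \<sigma>_def \<nu>_def)
    have \<sigma>: "borel_measure_on_unit \<sigma>" using \<nu> by (simp add: \<sigma>_def borel_measure_on_unit_def)
    have meas: "h \<in> borel_measurable \<mu> \<and> h \<in> borel_measurable \<nu> \<and> h \<in> borel_measurable \<sigma>"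
      if "continuous_on {0..<1} h" for h :: "real \<Rightarrow> real"
      using borel_measurable_unit_measure[OF \<mu> that] by (simp add: \<sigma>_def \<nu>_def)
    have fcont: "continuous_on {0..<1} (\<lambda>t. norm (f (of_real t)))"
      by (intro continuous_on_norm continuous_on_real_trace fhol)
    have \<sigma>m: "emeasure \<sigma> (space \<sigma>) \<le> ennreal (C * N)"
    proof -
      have "emeasure \<sigma> (space \<sigma>) = (\<integral>\<^sup>+t. ennreal (norm (f (of_real t))) \<partial>\<nu>)"
        using meas[OF fcont] unfolding \<sigma>_def by (subst emeasure_density) (auto intro!: nn_integral_cong simp: indicator_def)
      then show ?thesis using C[OF f] by (simp add: N_def)
    qed
    interpret S: finite_measure \<sigma>
      using \<sigma>m by (intro finite_measureI) (auto simp: top_unique)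
    interpret A: finite_measure disc_area by (rule finite_measure_disc_area)
    interpret P: pair_sigma_finite disc_area \<sigma>
      by (intro pair_sigma_finite.intro A.sigma_finite_measure_axioms S.sigma_finite_measure_axioms)
    define m where "m = measure \<sigma> (space \<sigma>)"
    have m: "0 \<le> m" "m \<le> C * N"
      using \<sigma>m C0 N0 by (auto simp: m_def S.emeasure_eq_measure)
    define x where "x z t = norm (1 - of_real t * z) powr (- (\<alpha> + 1)) / W t" for z :: complex and t :: real
    have lower: "1 - norm z \<le> norm (1 - of_real t * z)" if "norm z < 1" "0 \<le> t" "t < 1" for z :: complex and t
    proof -
      have "norm (of_real t * z) \<le> norm z" using that by (simp add: norm_mult mult_left_le_one_le)
      then show ?thesis using norm_triangle_ineq2[of 1 "of_real t * z"] by simp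
    qed
    have xcont: "continuous_on {0..<1} (x z)" if z: "norm z < 1" for z
      unfolding x_def using lower[OF z] z pos
      by (intro continuous_intros cont) (force simp: less_imp_neq)+
    have xnn: "0 \<le> x z t" if "0 \<le> t" "t < 1" for z t
      using pos[OF that] by (simp add: x_def)
    have ptw: "norm (g z) powr q \<le> 2 powr q * m powr (q - 1) * (LINT t|\<sigma>. x z t powr q)"
      and xint: "integrable \<sigma> (\<lambda>t. x z t powr q)" if z: "norm z < 1" for z
    proof -
      note xm = meas[OF xcont[OF z]]
      define b where "b = (1 - norm z) powr (- (\<alpha> + 1)) / W 0"
      have xb: "x z t \<le> b" if t: "0 \<le> t" "t < 1" for t
        unfolding x_def b_def using lower[OF z t] z \<alpha> mono[of 0 t] t W0
        by (intro frac_le powr_mono2') auto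
      show xint: "integrable \<sigma> (\<lambda>t. x z t powr q)"
      proof (rule S.integrable_const_bound[where B="b powr q"])
        show "AE t in \<sigma>. norm (x z t powr q) \<le> b powr q"
          using xb xnn q by (intro AE_I2) (auto intro!: powr_mono2)
        have [measurable]: "x z \<in> borel_measurable \<sigma>" using xm by simp
        show "(\<lambda>t. x z t powr q) \<in> borel_measurable \<sigma>" by measurable
      qed
      have "norm (g z) = norm (LINT t|\<mu>. f (of_real t) * (1 - of_real t * z) powr of_real (- (\<alpha> + 1)))"
        by (simp only: rep[OF z])
      also have "\<dots> \<le> (LINT t|\<mu>. norm (f (of_real t) * (1 - of_real t * z) powr of_real (- (\<alpha> + 1))))"
        by (rule integral_norm_bound)
      also have "\<dots> = (LINT t|\<mu>. W t * (norm (f (of_real t)) * x z t))"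
      proof (rule Bochner_Integration.integral_cong[OF refl])
        fix t assume "t \<in> space \<mu>"
        then have t: "0 \<le> t" "t < 1" by (auto simp: space_unit_measure[OF \<mu>])
        have "norm ((1 - of_real t * z) powr of_real (- (\<alpha> + 1))) = norm (1 - of_real t * z) powr (- (\<alpha> + 1))"
          by (subst norm_powr_real_powr') auto
        then show "norm (f (of_real t) * (1 - of_real t * z) powr of_real (- (\<alpha> + 1))) = W t * (norm (f (of_real t)) * x z t)"
          using pos[OF t] by (simp add: norm_mult x_def)
      qed
      also have "\<dots> = (LINT t|\<nu>. norm (f (of_real t)) * x z t)"
        unfolding \<nu>_def using xm meas[OF fcont] meas[OF cont] pos
        by (subst integral_real_density) (auto simp: space_unit_measure[OF \<mu>] less_imp_le intro!: AE_I2)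
      also have "\<dots> = (LINT t|\<sigma>. x z t)"
        unfolding \<sigma>_def using xm meas[OF fcont] by (subst integral_real_density) auto
      finally have gI: "norm (g z) \<le> (LINT t|\<sigma>. x z t)" .
      have "norm (g z) powr q \<le> (LINT t|\<sigma>. x z t) powr q"
        using gI q by (intro powr_mono2) auto
      also have "\<dots> \<le> 2 powr q * m powr (q - 1) * (LINT t|\<sigma>. x z t powr q)"
        unfolding m_def using xm xnn by (intro S.power_mean_inequality(2) q xint) auto
      finally show "norm (g z) powr q \<le> 2 powr q * m powr (q - 1) * (LINT t|\<sigma>. x z t powr q)" .
    qed
    have joint: "(\<lambda>(z, t). ennreal (x z t powr q)) \<in> borel_measurable (disc_area \<Otimes>\<^sub>M \<sigma>)"
    proof -
      have idz: "(\<lambda>z. z) \<in> borel_measurable disc_area"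
        by (intro borel_measurable_disc_area continuous_intros)
      have [measurable]: "fst \<in> borel_measurable (disc_area \<Otimes>\<^sub>M \<sigma>)"
        by (rule measurable_compose[OF measurable_fst idz])
      have idt: "(\<lambda>t. t) \<in> borel_measurable \<sigma>"
        using meas[OF continuous_on_id] by simp
      have [measurable]: "snd \<in> borel_measurable (disc_area \<Otimes>\<^sub>M \<sigma>)"
        by (rule measurable_compose[OF measurable_snd idt])
      have Wt: "W \<in> borel_measurable \<sigma>" using meas[OF cont] by simp
      have [measurable]: "(\<lambda>y. W (snd y)) \<in> borel_measurable (disc_area \<Otimes>\<^sub>M \<sigma>)"
        by (rule measurable_compose[OF measurable_snd Wt])
      show ?thesis unfolding x_def case_prod_beta by measurable
    qed
    have inner: "(\<integral>\<^sup>+z. ennreal (x z t powr q) \<partial>disc_area) \<le> ennreal B" if "t \<in> space \<sigma>" for t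
    proof -
      have t: "0 \<le> t" "t < 1" using that by auto
      have zm: "(\<lambda>z. norm (1 - of_real t * z) powr (- (q * (\<alpha> + 1)))) \<in> borel_measurable disc_area"
      proof (intro borel_measurable_disc_area continuous_intros ballI)
        fix z :: complex assume "z \<in> ball 0 1"
        then show "norm (1 - of_real t * z) \<noteq> 0" using lower[OF _ t, of z] by force
      qed
      have "ennreal (x z t powr q) = ennreal (W t powr (- q)) * ennreal (norm (1 - of_real t * z) powr (- (q * (\<alpha> + 1))))" for z
      proof -
        have "x z t powr q = W t powr (- q) * norm (1 - of_real t * z) powr (- (q * (\<alpha> + 1)))"
        proof -
          have "x z t powr q = (norm (1 - of_real t * z) powr (- (\<alpha> + 1))) powr q / W t powr q"
            using pos[OF t] unfolding x_def by (intro powr_divide)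
          also have "\<dots> = norm (1 - of_real t * z) powr (- (\<alpha> + 1) * q) / W t powr q"
            by (simp only: powr_powr)
          also have "- (\<alpha> + 1) * q = - (q * (\<alpha> + 1))" by (simp add: algebra_simps)
          finally show ?thesis by (simp only: powr_minus[of "W t"] divide_inverse mult.commute)
        qed
        then show ?thesis by (simp add: ennreal_mult')
      qed
      then have "(\<integral>\<^sup>+z. ennreal (x z t powr q) \<partial>disc_area)
          = ennreal (W t powr (- q)) * (\<integral>\<^sup>+z. ennreal (norm (1 - of_real t * z) powr (- (q * (\<alpha> + 1)))) \<partial>disc_area)"
        using zm by (simp add: nn_integral_cmult)
      also have "\<dots> \<le> ennreal (W t powr (- q)) * ennreal (B * W t powr q)"
        by (intro mult_left_mono kernel t) auto
      also have "\<dots> = ennreal B"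
        using pos[OF t] B by (simp add: powr_minus flip: ennreal_mult)
      finally show ?thesis .
    qed
    have "(\<integral>\<^sup>+z. ennreal (norm (g z) powr q) \<partial>disc_area)
        \<le> (\<integral>\<^sup>+z. ennreal (2 powr q * m powr (q - 1)) * (\<integral>\<^sup>+t. ennreal (x z t powr q) \<partial>\<sigma>) \<partial>disc_area)"
    proof (intro nn_integral_mono)
      fix z assume "z \<in> space disc_area"
      then have z: "norm z < 1" by simp
      have "(\<integral>\<^sup>+t. ennreal (x z t powr q) \<partial>\<sigma>) = ennreal (LINT t|\<sigma>. x z t powr q)"
        by (intro nn_integral_eq_integral xint z) auto
      then show "ennreal (norm (g z) powr q)
          \<le> ennreal (2 powr q * m powr (q - 1)) * (\<integral>\<^sup>+t. ennreal (x z t powr q) \<partial>\<sigma>)"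
        using ptw[OF z] by (simp add: ennreal_leI flip: ennreal_mult')
    qed
    also have "\<dots> = ennreal (2 powr q * m powr (q - 1)) * (\<integral>\<^sup>+z. \<integral>\<^sup>+t. ennreal (x z t powr q) \<partial>\<sigma> \<partial>disc_area)"
      using S.borel_measurable_nn_integral[OF joint] by (intro nn_integral_cmult)
    also have "(\<integral>\<^sup>+z. \<integral>\<^sup>+t. ennreal (x z t powr q) \<partial>\<sigma> \<partial>disc_area) = (\<integral>\<^sup>+t. \<integral>\<^sup>+z. ennreal (x z t powr q) \<partial>disc_area \<partial>\<sigma>)"
      by (rule P.Fubini'[OF joint, symmetric])
    also have "ennreal (2 powr q * m powr (q - 1)) * (\<integral>\<^sup>+t. \<integral>\<^sup>+z. ennreal (x z t powr q) \<partial>disc_area \<partial>\<sigma>)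
        \<le> ennreal (2 powr q * m powr (q - 1)) * (\<integral>\<^sup>+t. ennreal B \<partial>\<sigma>)"
      by (intro mult_left_mono nn_integral_mono inner) auto
    also have "\<dots> = ennreal (2 powr q * m powr (q - 1) * (B * m))"
      using B m by (simp add: S.emeasure_eq_measure m_def flip: ennreal_mult')
    also have "2 powr q * m powr (q - 1) * (B * m) = 2 powr q * B * m powr q"
      using m by (cases "m = 0") (simp_all add: powr_diff)
    also have "ennreal \<dots> \<le> ennreal (2 powr q * B * (C * N) powr q)"
      using B m q by (intro ennreal_leI mult_left_mono powr_mono2) auto
    finally have fin: "(\<integral>\<^sup>+z. ennreal (norm (g z) powr q) \<partial>disc_area) \<le> ennreal (2 powr q * B * (C * N) powr q)" .
    have gm: "(\<lambda>z. norm (g z) powr q) \<in> borel_measurable disc_area"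
    proof -
      have "(\<lambda>z. norm (g z)) \<in> borel_measurable disc_area"
        by (intro borel_measurable_disc_area continuous_on_norm holomorphic_on_imp_continuous_on ghol)
      then show ?thesis by measurable
    qed
    have gint: "integrable disc_area (\<lambda>z. norm (g z) powr q)"
      using fin by (intro integrableI_bounded gm) (auto simp: less_top[symmetric] top_unique)
    have "ennreal (LINT z|disc_area. norm (g z) powr q) \<le> ennreal (2 powr q * B * (C * N) powr q)"
      using fin nn_integral_eq_integral[OF gint] by simp
    then have "(LINT z|disc_area. norm (g z) powr q) \<le> 2 powr q * B * (C * N) powr q"
      using B by (simp add: ennreal_le_iff)
    then have "bergman_norm q g \<le> (2 powr q * B * (C * N) powr q) powr (1 / q)"
      unfolding bergman_norm_def using q by (intro powr_mono2 integral_nonneg_AE) auto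
    also have "\<dots> = 2 * B powr (1 / q) * C * N"
      using B C0 N0 q by (simp add: powr_mult powr_powr)
    finally have "bergman_norm q g \<le> 2 * B powr (1 / q) * C * N" .
    then show ?thesis
      using def ghol gint by (simp add: bergman_space_def g_def N_def)
  qed
  have "2 * B powr (1 / q) * C > 0" using B C0 by simp
  then show ?thesis unfolding hilbert_op_bounded_def using main by blast
qed

section \<open>Necessity, and the three cases\<close>

text \<open>
  The mean value inequality on a disc of half the distance to the boundary, combined with the power mean
  inequality on that disc.
\<close>

lemma bergman_growth_large_exponent:
  fixes q :: real
  assumes q: "1 < q"
  obtains C where "C > 0"
    "\<And>f z. f \<in> bergman_space q \<Longrightarrow> norm z < 1 \<Longrightarrow>
       norm (f z) \<le> C * bergman_norm q f * (1 - norm z) powr (- (2 / q))"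
proof
  let ?K = "2 powr q * 4 powr (q - 1) :: real"
  show "?K powr (1 / q) * 2 powr (2 / q) > 0" by simp
  fix f z assume f: "f \<in> bergman_space q" and z: "norm (z::complex) < 1"
  then have hol: "f holomorphic_on ball 0 1" and int: "integrable disc_area (\<lambda>w. norm (f w) powr q)"
    by (auto simp: bergman_space_def)
  define I where "I = (LINT w|disc_area. norm (f w) powr q)"
  have I0: "0 \<le> I" unfolding I_def by (rule Bochner_Integration.integral_nonneg) auto
  define r where "r = (1 - norm z) / 2"
  have r: "0 < r" "r < 1 - norm z" using z by (auto simp: r_def field_simps)
  have sub: "cball z r \<subseteq> ball 0 1" by (rule cball_subset_unit_disc[OF r(2)])
  have Bm: "cball z r \<in> sets disc_area"
    using sub by (simp add: sets_disc_area sets_restrict_space_iff)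
  have fm: "f \<in> borel_measurable disc_area"
    by (intro borel_measurable_disc_area holomorphic_on_imp_continuous_on hol)
  define \<sigma> where "\<sigma> = density disc_area (\<lambda>w. ennreal (indicator (cball z r) w))"
  have \<sigma>: "emeasure \<sigma> (space \<sigma>) \<le> ennreal (4 * r\<^sup>2)"
  proof -
    have im: "(\<lambda>w. ennreal (indicator (cball z r) w)) \<in> borel_measurable disc_area"
      using Bm by measurable
    have "emeasure \<sigma> (space \<sigma>) = (\<integral>\<^sup>+w. indicator (cball z r) w \<partial>disc_area)"
      unfolding \<sigma>_def space_density emeasure_density[OF im sets.top]
      by (intro nn_integral_cong) (simp add: ennreal_indicator)
    also have "\<dots> = emeasure disc_area (cball z r)" using Bm by simp
    also have "\<dots> \<le> ennreal ((2 * r)\<^sup>2)"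
      using r sub by (intro emeasure_disc_area_le_ball[where c=z]) auto
    finally show ?thesis by (simp add: power2_eq_square)
  qed
  interpret S: finite_measure \<sigma> using \<sigma> by (intro finite_measureI) (auto simp: top_unique)
  define m where "m = measure \<sigma> (space \<sigma>)"
  have m: "0 \<le> m" "m \<le> 4 * r\<^sup>2" using \<sigma> by (auto simp: m_def S.emeasure_eq_measure)
  have nfq: "(\<lambda>w. norm (f w) powr q) \<in> borel_measurable disc_area" using int by simp
  have iq: "integrable disc_area (\<lambda>w. indicator (cball z r) w * norm (f w) powr q)"
  proof (rule Bochner_Integration.integrable_bound[OF int])
    show "(\<lambda>w. indicator (cball z r) w * norm (f w) powr q) \<in> borel_measurable disc_area"
      by (intro borel_measurable_times borel_measurable_indicator Bm nfq)
  qed (auto simp: indicator_def)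
  have i\<sigma>: "integrable \<sigma> (\<lambda>w. norm (f w) powr q)"
    unfolding \<sigma>_def using Bm nfq iq by (subst integrable_real_density) auto
  have "norm (f z) * r\<^sup>2 \<le> (LINT w|disc_area. indicator (cball z r) w * norm (f w))"
    by (rule norm_le_disc_area_average[OF hol r])
  also have "\<dots> = (LINT w|\<sigma>. norm (f w))"
    unfolding \<sigma>_def using Bm fm by (subst integral_real_density) auto
  finally have "(norm (f z) * r\<^sup>2) powr q \<le> (LINT w|\<sigma>. norm (f w)) powr q"
    using q by (intro powr_mono2) auto
  also have "\<dots> \<le> 2 powr q * m powr (q - 1) * (LINT w|\<sigma>. norm (f w) powr q)"
    unfolding m_def using fm by (intro S.power_mean_inequality(2) q i\<sigma>) (auto simp: \<sigma>_def)
  also have "(LINT w|\<sigma>. norm (f w) powr q) = (LINT w|disc_area. indicator (cball z r) w * norm (f w) powr q)"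
    unfolding \<sigma>_def using Bm nfq by (subst integral_real_density) auto
  also have "\<dots> \<le> I"
    unfolding I_def by (intro integral_mono iq int) (auto simp: indicator_def)
  finally have "(norm (f z) * r\<^sup>2) powr q \<le> 2 powr q * m powr (q - 1) * I"
    by (simp add: mult_left_mono)
  also have "\<dots> \<le> 2 powr q * (4 * r\<^sup>2) powr (q - 1) * I"
    using m q I0 by (intro mult_left_mono mult_right_mono powr_mono2) auto
  finally have "((norm (f z) * r\<^sup>2) powr q) powr (1 / q) \<le> (2 powr q * (4 * r\<^sup>2) powr (q - 1) * I) powr (1 / q)"
    using q by (intro powr_mono2) auto
  also have "((norm (f z) * r\<^sup>2) powr q) powr (1 / q) = norm (f z) * r\<^sup>2"
    using q by (simp add: powr_powr)
  also have "(2 powr q * (4 * r\<^sup>2) powr (q - 1) * I) powr (1 / q) = ?K powr (1 / q) * bergman_norm q f * r powr (2 * ((q - 1) / q))"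
  proof -
    have "(r\<^sup>2) powr (q - 1) = r powr (2 * (q - 1))"
      using r by (simp add: powr_powr flip: powr_numeral)
    then show ?thesis
      using I0 r by (simp add: powr_mult powr_powr bergman_norm_def I_def)
  qed
  finally have "norm (f z) \<le> ?K powr (1 / q) * bergman_norm q f * r powr (2 * ((q - 1) / q)) / r\<^sup>2"
    using r by (simp add: field_simps)
  also have "\<dots> = ?K powr (1 / q) * bergman_norm q f * r powr (- (2 / q))"
  proof -
    have "r powr (2 * ((q - 1) / q)) / r\<^sup>2 = r powr (2 * ((q - 1) / q) - 2)"
      using r by (simp add: powr_diff)
    also have "2 * ((q - 1) / q) - 2 = - (2 / q)" using q by (simp add: field_simps)
    finally show ?thesis by (simp only: times_divide_eq_right[symmetric])
  qed
  also have "r powr (- (2 / q)) = 2 powr (2 / q) * (1 - norm z) powr (- (2 / q))"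
    using z by (simp add: r_def powr_divide powr_minus_divide)
  finally show "norm (f z) \<le> ?K powr (1 / q) * 2 powr (2 / q) * bergman_norm q f * (1 - norm z) powr (- (2 / q))"
    by (simp only: mult_ac)
qed

text \<open>
  These are the test functions of the necessity part; the condition on \<open>n\<close> places their \<open>A\<^sup>p\<close> norm in the range
  where the kernel integral is a power of \<open>1 - a\<close>.
\<close>

lemma bergman_norm_power_kernel:
  fixes p :: real and n :: nat
  assumes p: "0 < p" and n: "real n * p > 2"
  obtains C where "C > 0"
    "\<And>a. 0 \<le> a \<Longrightarrow> a < 1 \<Longrightarrow> (\<lambda>z. inverse (1 - of_real a * z) ^ n) \<in> bergman_space p"
    "\<And>a. 0 \<le> a \<Longrightarrow> a < 1 \<Longrightarrow>
       bergman_norm p (\<lambda>z. inverse (1 - of_real a * z) ^ n) \<le> C * (1 - a) powr (2 / p - real n)"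
proof
  let ?c = "real n * p"
  let ?K = "16 * 4 powr (?c - 2) / (2 powr (?c - 2) - 1) :: real"
  have K: "?K > 0" using n powr_less_cancel_iff[of 2 0 "?c - 2"] by simp
  show "?K powr (1 / p) > 0" using n by simp
  fix a :: real assume a: "0 \<le> a" "a < 1"
  let ?f = "\<lambda>z::complex. inverse (1 - of_real a * z) ^ n"
  have nz: "1 - of_real a * z \<noteq> 0" if "z \<in> ball 0 1" for z :: complex
  proof
    assume "1 - of_real a * z = 0"
    then have "norm (of_real a * z) = 1" by simp
    moreover have "norm (of_real a * z) < 1"
      using a that by (auto simp: norm_mult intro: le_less_trans[OF mult_left_le])
    ultimately show False by simp
  qed
  have hol: "?f holomorphic_on ball 0 1"
    using nz by (intro holomorphic_intros) auto
  have eq: "norm (?f z) powr p = norm (1 - of_real a * z) powr (- ?c)" for z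
  proof (cases "1 - of_real a * z = 0")
    case True
    then show ?thesis using n p by (cases n) auto
  next
    case False
    then have "norm (?f z) = norm (1 - of_real a * z) powr (- real n)"
      by (simp add: norm_power norm_inverse powr_minus powr_realpow power_inverse)
    then show ?thesis by (simp add: powr_powr)
  qed
  have fin: "(\<integral>\<^sup>+z. ennreal (norm (?f z) powr p) \<partial>disc_area) \<le> ennreal (?K * (1 - a) powr (2 - ?c))"
    unfolding eq by (rule integral_kernel_supercritical[OF n a])
  have "(\<lambda>z. norm (?f z) powr p) \<in> borel_measurable disc_area"
  proof -
    define h where "h z = norm (?f z)" for z
    have [measurable]: "h \<in> borel_measurable disc_area"
      unfolding h_def
      by (intro borel_measurable_disc_area continuous_on_norm holomorphic_on_imp_continuous_on hol)
    show ?thesis unfolding h_def[symmetric] by measurable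
  qed
  then have int: "integrable disc_area (\<lambda>z. norm (?f z) powr p)"
    using fin by (intro integrableI_bounded) (auto simp: less_top[symmetric] top_unique)
  then show "?f \<in> bergman_space p" using hol by (simp add: bergman_space_def)
  have "ennreal (LINT z|disc_area. norm (?f z) powr p) \<le> ennreal (?K * (1 - a) powr (2 - ?c))"
    using fin nn_integral_eq_integral[OF int] by simp
  then have "(LINT z|disc_area. norm (?f z) powr p) \<le> ?K * (1 - a) powr (2 - ?c)"
    by (subst (asm) ennreal_le_iff) (rule mult_nonneg_nonneg[OF less_imp_le[OF K] powr_ge_zero])
  then have "bergman_norm p ?f \<le> (?K * (1 - a) powr (2 - ?c)) powr (1 / p)"
    unfolding bergman_norm_def using p by (intro powr_mono2 integral_nonneg_AE) auto
  also have "\<dots> = ?K powr (1 / p) * (1 - a) powr ((2 - ?c) * (1 / p))"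
    using K a by (simp only: powr_mult powr_powr)
  also have "(2 - ?c) * (1 / p) = 2 / p - real n" using p by (simp add: field_simps)
  finally show "bergman_norm p ?f \<le> ?K powr (1 / p) * (1 - a) powr (2 / p - real n)" .
qed

lemma ln_e_over_ge_1:
  fixes t :: real
  assumes "0 \<le> t" "t < 1"
  shows "ln (exp 1 / (1 - t)) \<ge> 1"
proof -
  have "ln (exp 1 / (1 - t)) = 1 - ln (1 - t)" using assms by (simp add: ln_div)
  moreover have "ln (1 - t) \<le> 0" using assms by simp
  ultimately show ?thesis by simp
qed

lemma carleson_iff:
  "carleson s \<mu> \<longleftrightarrow> (\<exists>M>0. \<forall>t. 0 \<le> t \<longrightarrow> t < 1 \<longrightarrow> emeasure \<mu> {t..<1} \<le> ennreal (M * (1 - t) powr s))"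
proof -
  have "ln (exp 1 / (1 - t)) powr 0 = 1" if "t \<in> {0..<1}" for t :: real
    using ln_e_over_ge_1[of t] that by auto
  then show ?thesis by (auto simp: carleson_def log_carleson_def)
qed

text \<open>
  The integrand is positive, and for \<open>t \<ge> a\<close> one has \<open>1 - a t \<le> 1 - a\<^sup>2 \<le> 2 (1 - a)\<close>; so restricting the
  integral to \<open>[a, 1)\<close> gives the bound.
\<close>

lemma norm_kernel_integral_ge:
  fixes a \<beta> :: real and n :: nat
  assumes \<mu>: "borel_measure_on_unit \<mu>" and fin: "finite_measure \<mu>" and a: "0 \<le> a" "a < 1" and \<beta>: "\<beta> > 0"
  shows "(2 * (1 - a)) powr (- (real n + \<beta>)) * measure \<mu> {a..<1}
       \<le> norm (LINT t|\<mu>. inverse (1 - of_real a * of_real t) ^ n * (1 - of_real t * of_real a) powr (complex_of_real (- \<beta>)))"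
proof -
  interpret finite_measure \<mu> by (rule fin)
  have at: "0 < 1 - a * t" if "0 \<le> t" "t < 1" for t
    using that a mult_le_one[of a t] mult_left_le[of t a] by auto
  define k where "k t = (1 - a * t) powr (- (real n + \<beta>))" for t
  have km: "k \<in> borel_measurable \<mu>"
  proof (rule borel_measurable_unit_measure[OF \<mu>])
    show "continuous_on {0..<1} k"
      unfolding k_def using at by (intro continuous_intros) (force simp: less_imp_neq)+
  qed
  have kint: "integrable \<mu> k"
  proof (rule integrable_const_bound[where B="(1 - a) powr (- (real n + \<beta>))"])
    show "AE t in \<mu>. norm (k t) \<le> (1 - a) powr (- (real n + \<beta>))"
    proof (rule AE_I2)
      fix t assume "t \<in> space \<mu>"
      then have t: "0 \<le> t" "t < 1" by (auto simp: space_unit_measure[OF \<mu>])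
      have "1 - a \<le> 1 - a * t" using a t by (simp add: mult_left_le)
      then show "norm (k t) \<le> (1 - a) powr (- (real n + \<beta>))"
        unfolding k_def using a \<beta> by (auto intro!: powr_mono2')
    qed
  qed (rule km)
  have am: "{a..<1} \<in> sets \<mu>" using a by (intro sets_unit_measure[OF \<mu>]) auto
  have "(2 * (1 - a)) powr (- (real n + \<beta>)) * measure \<mu> {a..<1}
      = (LINT t|\<mu>. (2 * (1 - a)) powr (- (real n + \<beta>)) * indicator {a..<1} t)"
    using am by simp
  also have "\<dots> \<le> (LINT t|\<mu>. k t)"
  proof (intro integral_mono kint integrable_mult_right)
    show "integrable \<mu> (indicator {a..<1} :: real \<Rightarrow> real)"
      using am by (simp add: emeasure_eq_measure)
    fix t assume "t \<in> space \<mu>"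
    then have t: "0 \<le> t" "t < 1" by (auto simp: space_unit_measure[OF \<mu>])
    show "(2 * (1 - a)) powr (- (real n + \<beta>)) * indicator {a..<1} t \<le> k t"
    proof (cases "a \<le> t")
      case True
      have "a * a \<le> a * t" using True a by (intro mult_left_mono) auto
      moreover have "1 - a * a \<le> 2 * (1 - a)" using zero_le_power2[of "1 - a"] by (simp add: power2_eq_square algebra_simps)
      ultimately have "1 - a * t \<le> 2 * (1 - a)" by linarith
      then show ?thesis
        unfolding k_def using at[OF t] \<beta> True t by (auto intro!: powr_mono2')
    qed (simp add: k_def)
  qed
  also have "\<dots> \<le> norm (complex_of_real (LINT t|\<mu>. k t))" by simp
  also have "complex_of_real (LINT t|\<mu>. k t) = (LINT t|\<mu>. of_real (k t))"
    by (rule integral_complex_of_real[symmetric])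
  also have "\<dots> = (LINT t|\<mu>. inverse (1 - of_real a * of_real t) ^ n * (1 - of_real t * of_real a) powr (complex_of_real (- \<beta>)))"
  proof (rule Bochner_Integration.integral_cong[OF refl])
    fix t assume "t \<in> space \<mu>"
    then have t: "0 \<le> t" "t < 1" by (auto simp: space_unit_measure[OF \<mu>])
    note p = at[OF t]
    have c: "1 - complex_of_real a * of_real t = of_real (1 - a * t)"
      "1 - complex_of_real t * of_real a = of_real (1 - a * t)" by simp_all
    have "(complex_of_real (1 - a * t)) powr (of_real (- \<beta>)) = of_real ((1 - a * t) powr (- \<beta>))"
      using p by (intro powr_of_real) auto
    moreover have "k t = inverse (1 - a * t) ^ n * (1 - a * t) powr (- \<beta>)"
    proof -
      have "k t = (1 - a * t) powr (- real n) * (1 - a * t) powr (- \<beta>)"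
        by (simp add: k_def flip: powr_add)
      also have "(1 - a * t) powr (- real n) = inverse (1 - a * t) ^ n"
        using p by (simp add: powr_minus powr_realpow power_inverse)
      finally show ?thesis .
    qed
    ultimately show "of_real (k t) = inverse (1 - of_real a * of_real t) ^ n * (1 - of_real t * of_real a) powr (complex_of_real (- \<beta>))"
      unfolding c by (simp only: of_real_mult of_real_power of_real_inverse)
  qed
  finally show ?thesis .
qed

text \<open>
  The lower bound for \<open>H f(a)\<close> and the upper bound from growth and boundedness are compared for the test function
  \<open>f(z) = inverse (1 - a z) ^ n\<close>; the powers involving \<open>n\<close> cancel.
\<close>

lemma carleson_of_hilbert_op_bounded:
  fixes p q \<alpha> :: real
  assumes p: "0 < p" "p \<le> 1" and q: "1 < q" and \<alpha>: "\<alpha> > -1" and \<mu>: "borel_measure_on_unit \<mu>"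
    and car: "carleson (2 / p) \<mu>" and bdd: "hilbert_op_bounded \<mu> \<alpha> p q"
  shows "carleson (2 / p + (\<alpha> + 1 - 2 / q)) \<mu>"
proof -
  obtain M where M: "M > 0"
    and tail: "\<And>t. 0 \<le> t \<Longrightarrow> t < 1 \<Longrightarrow> emeasure \<mu> {t..<1} \<le> ennreal (M * (1 - t) powr (2 / p))"
    using car unfolding carleson_iff by blast
  have fin: "finite_measure \<mu>" using tail by (rule finite_measure_of_tail[OF \<mu>])
  interpret finite_measure \<mu> by (rule fin)
  obtain C where C: "C > 0"
    and bd: "\<And>f. f \<in> bergman_space p \<Longrightarrow> hilbert_op \<mu> \<alpha> f \<in> bergman_space q"
    "\<And>f. f \<in> bergman_space p \<Longrightarrow> bergman_norm q (hilbert_op \<mu> \<alpha> f) \<le> C * bergman_norm p f"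
    using bdd unfolding hilbert_op_bounded_def by blast
  obtain G where G: "G > 0"
    "\<And>f z. f \<in> bergman_space q \<Longrightarrow> norm z < 1 \<Longrightarrow>
       norm (f z) \<le> G * bergman_norm q f * (1 - norm z) powr (- (2 / q))"
    using bergman_growth_large_exponent[OF q] by blast
  obtain n :: nat where "2 / p < real n" using reals_Archimedean2 by blast
  then have n: "real n * p > 2" using p by (simp add: field_simps)
  obtain T where T: "T > 0"
    "\<And>a. 0 \<le> a \<Longrightarrow> a < 1 \<Longrightarrow> (\<lambda>z. inverse (1 - of_real a * z) ^ n) \<in> bergman_space p"
    "\<And>a. 0 \<le> a \<Longrightarrow> a < 1 \<Longrightarrow>
       bergman_norm p (\<lambda>z. inverse (1 - of_real a * z) ^ n) \<le> T * (1 - a) powr (2 / p - real n)"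
    using bergman_norm_power_kernel[OF p(1) n] by blast
  define c where "c = real n + (\<alpha> + 1)"
  let ?K = "G * C * T * 2 powr c"
  have K: "?K > 0" using G C T by simp
  have "emeasure \<mu> {a..<1} \<le> ennreal (?K * (1 - a) powr (2 / p + (\<alpha> + 1 - 2 / q)))"
    if a: "0 \<le> a" "a < 1" for a
  proof -
    define f where "f z = inverse (1 - of_real a * z) ^ n" for z :: complex
    have f: "f \<in> bergman_space p" unfolding f_def by (rule T(2)[OF a])
    have na: "norm (complex_of_real a) < 1" using a by simp
    have "(2 * (1 - a)) powr (- c) * measure \<mu> {a..<1} \<le> norm (hilbert_op \<mu> \<alpha> f (of_real a))"
    proof -
      have "hilbert_op \<mu> \<alpha> f (of_real a)
          = (LINT t|\<mu>. f (of_real t) * (1 - of_real t * of_real a) powr of_real (- (\<alpha> + 1)))"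
        by (rule hilbert_op_integral_representation(2)[OF p \<alpha> \<mu> M _ f na]) (rule tail)
      then show ?thesis
        using norm_kernel_integral_ge[OF \<mu> fin a, of "\<alpha> + 1" n] \<alpha>
        unfolding f_def c_def by simp
    qed
    also have "\<dots> \<le> G * bergman_norm q (hilbert_op \<mu> \<alpha> f) * (1 - norm (complex_of_real a)) powr (- (2 / q))"
      by (rule G(2)[OF bd(1)[OF f] na])
    also have "\<dots> \<le> G * (C * (T * (1 - a) powr (2 / p - real n))) * (1 - norm (complex_of_real a)) powr (- (2 / q))"
    proof (intro mult_right_mono mult_left_mono)
      have "bergman_norm p f \<le> T * (1 - a) powr (2 / p - real n)" unfolding f_def by (rule T(3)[OF a])
      then show "bergman_norm q (hilbert_op \<mu> \<alpha> f) \<le> C * (T * (1 - a) powr (2 / p - real n))"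
        using C by (intro order_trans[OF bd(2)[OF f]] mult_left_mono) auto
    qed (use G in auto)
    also have "\<dots> = G * C * T * ((1 - a) powr (2 / p - real n) * (1 - a) powr (- (2 / q)))"
      using a by simp
    finally have "(2 * (1 - a)) powr c * ((2 * (1 - a)) powr (- c) * measure \<mu> {a..<1})
        \<le> (2 * (1 - a)) powr c * (G * C * T * ((1 - a) powr (2 / p - real n) * (1 - a) powr (- (2 / q))))"
      by (rule mult_left_mono) simp
    also have "(2 * (1 - a)) powr c * ((2 * (1 - a)) powr (- c) * measure \<mu> {a..<1}) = measure \<mu> {a..<1}"
      using a by (simp add: powr_minus)
    also have "(2 * (1 - a)) powr c * (G * C * T * ((1 - a) powr (2 / p - real n) * (1 - a) powr (- (2 / q))))
        = ?K * ((1 - a) powr c * ((1 - a) powr (2 / p - real n) * (1 - a) powr (- (2 / q))))"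
      by (simp only: powr_mult mult_ac)
    also have "(1 - a) powr c * ((1 - a) powr (2 / p - real n) * (1 - a) powr (- (2 / q)))
        = (1 - a) powr (c + ((2 / p - real n) + - (2 / q)))"
      by (simp only: powr_add)
    also have "c + ((2 / p - real n) + - (2 / q)) = 2 / p + (\<alpha> + 1 - 2 / q)"
      by (simp add: c_def)
    finally show ?thesis by (simp add: emeasure_eq_measure ennreal_leI)
  qed
  then show ?thesis unfolding carleson_iff using K by blast
qed

theorem theorem3p7:
  fixes p q q' \<alpha> :: real and \<mu> :: "real measure"
  assumes "0 < p" and "p \<le> 1" and "1 < q" and "\<alpha> > -1"
    and "q' = q / (q - 1)"
    and "borel_measure_on_unit \<mu>"
    and "carleson (2 / p) \<mu>"
  shows "(\<alpha> + 1 - 2 / q > 0 \<longrightarrow>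
            (hilbert_op_bounded \<mu> \<alpha> p q \<longleftrightarrow> carleson (2 / p + 2 / q' + \<alpha> - 1) \<mu>)) \<and>
         (\<alpha> + 1 - 2 / q < 0 \<longrightarrow> hilbert_op_bounded \<mu> \<alpha> p q) \<and>
         (\<alpha> + 1 - 2 / q = 0 \<and> log_carleson (1 / q) (2 / p) \<mu> \<longrightarrow> hilbert_op_bounded \<mu> \<alpha> p q)"
proof -
  note p = assms(1,2) and q = assms(3) and \<alpha> = assms(4) and \<mu> = assms(6) and car = assms(7)
  define \<delta> where "\<delta> = \<alpha> + 1 - 2 / q"
  define c where "c = q * (\<alpha> + 1)"
  have c: "c > 0" using q \<alpha> by (simp add: c_def)
  have cd: "c - 2 = q * \<delta>" using q by (simp add: c_def \<delta>_def field_simps)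
  have exponent: "2 / p + 2 / q' + \<alpha> - 1 = 2 / p + \<delta>"
    using q by (simp add: assms(5) \<delta>_def field_simps)
  have a_suff: "hilbert_op_bounded \<mu> \<alpha> p q" if \<delta>: "\<delta> > 0" and car': "carleson (2 / p + \<delta>) \<mu>"
  proof -
    obtain M where M: "M > 0"
      and tail: "\<And>t. 0 \<le> t \<Longrightarrow> t < 1 \<Longrightarrow> emeasure \<mu> {t..<1} \<le> ennreal (M * (1 - t) powr (2 / p + \<delta>))"
      using car' unfolding carleson_iff by blast
    have c2: "c > 2" using cd mult_pos_pos[of q \<delta>] q \<delta> by linarith
    define B where "B = 16 * 4 powr (c - 2) / (2 powr (c - 2) - 1 :: real)"
    show ?thesis
    proof (rule hilbert_op_bounded_of_weight[OF p q \<alpha> \<mu>, where W="\<lambda>t. (1 - t) powr (- \<delta>)" and M=M and D="2 powr \<delta>" and B=B])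
      show "continuous_on {0..<1} (\<lambda>t::real. (1 - t) powr (- \<delta>))" by (intro continuous_intros) auto
      show "0 < (1 - t) powr (- \<delta>)" if "0 \<le> t" "t < 1" for t :: real using that by simp
      show "(1 - t) powr (- \<delta>) \<le> (1 - u) powr (- \<delta>)" if "0 \<le> t" "t \<le> u" "u < 1" for t u :: real
        using that \<delta> by (intro powr_mono2') auto
      show "(1 - (1 + t) / 2) powr (- \<delta>) \<le> 2 powr \<delta> * (1 - t) powr (- \<delta>)" if "0 \<le> t" "t < 1" for t :: real
      proof -
        have "1 - (1 + t) / 2 = (1 - t) / 2" by (simp add: field_simps)
        then show ?thesis using that by (simp add: powr_divide powr_minus field_simps)
      qed
      show "emeasure \<mu> {t..<1} * ennreal ((1 - t) powr (- \<delta>)) \<le> ennreal (M * (1 - t) powr (2 / p))"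
        if "0 \<le> t" "t < 1" for t
      proof -
        have "emeasure \<mu> {t..<1} * ennreal ((1 - t) powr (- \<delta>))
            \<le> ennreal (M * (1 - t) powr (2 / p + \<delta>)) * ennreal ((1 - t) powr (- \<delta>))"
          by (intro mult_right_mono tail that) auto
        also have "\<dots> = ennreal (M * ((1 - t) powr (2 / p + \<delta>) * (1 - t) powr (- \<delta>)))"
          using M by (simp add: mult.assoc flip: ennreal_mult)
        also have "(1 - t) powr (2 / p + \<delta>) * (1 - t) powr (- \<delta>) = (1 - t) powr (2 / p)"
          by (simp flip: powr_add)
        finally show ?thesis .
      qed
      show "(\<integral>\<^sup>+z. ennreal (norm (1 - of_real t * z) powr (- (q * (\<alpha> + 1)))) \<partial>disc_area)
          \<le> ennreal (B * ((1 - t) powr (- \<delta>)) powr q)" if "0 \<le> t" "t < 1" for t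
      proof -
        have "((1 - t) powr (- \<delta>)) powr q = (1 - t) powr (2 - c)"
          unfolding powr_powr by (rule arg_cong[where f="\<lambda>x. (1 - t) powr x"]) (use cd in \<open>simp add: mult.commute\<close>)
        then show ?thesis
          using integral_kernel_supercritical[OF c2 that] unfolding B_def c_def by simp
      qed
      show "B > 0" unfolding B_def using c2 by simp
    qed (use M in auto)
  qed
  have a_nec: "carleson (2 / p + \<delta>) \<mu>" if "hilbert_op_bounded \<mu> \<alpha> p q"
    unfolding \<delta>_def by (rule carleson_of_hilbert_op_bounded[OF p q \<alpha> \<mu> car that])
  have b: "hilbert_op_bounded \<mu> \<alpha> p q" if \<delta>: "\<delta> < 0"
  proof -
    obtain M where M: "M > 0"
      and tail: "\<And>t. 0 \<le> t \<Longrightarrow> t < 1 \<Longrightarrow> emeasure \<mu> {t..<1} \<le> ennreal (M * (1 - t) powr (2 / p))"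
      using car unfolding carleson_iff by blast
    have c2: "c < 2" using cd mult_pos_neg[of q \<delta>] q \<delta> by linarith
    show ?thesis
    proof (rule hilbert_op_bounded_of_weight[OF p q \<alpha> \<mu>, where W="\<lambda>_. 1" and M=M and D=1 and B="16 / (1 - 2 powr (c - 2))"])
      show "(\<integral>\<^sup>+z. ennreal (norm (1 - of_real t * z) powr (- (q * (\<alpha> + 1)))) \<partial>disc_area)
          \<le> ennreal (16 / (1 - 2 powr (c - 2)) * 1 powr q)" if "0 \<le> t" "t < 1" for t
        using integral_kernel_subcritical[OF c c2 that] by (simp add: c_def)
      show "16 / (1 - 2 powr (c - 2)) > 0"
        using c2 powr_less_cancel_iff[of 2 "c - 2" 0] by simp
    qed (use M tail in auto)
  qed
  have cc: "hilbert_op_bounded \<mu> \<alpha> p q" if \<delta>: "\<delta> = 0" and log: "log_carleson (1 / q) (2 / p) \<mu>"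
  proof -
    obtain M where M: "M > 0"
      and tail: "\<And>t. 0 \<le> t \<Longrightarrow> t < 1 \<Longrightarrow>
        emeasure \<mu> {t..<1} * ennreal (ln (exp 1 / (1 - t)) powr (1 / q)) \<le> ennreal (M * (1 - t) powr (2 / p))"
      using log unfolding log_carleson_def by auto
    have c2: "q * (\<alpha> + 1) = 2" using cd \<delta> by (simp add: c_def)
    show ?thesis
    proof (rule hilbert_op_bounded_of_weight[OF p q \<alpha> \<mu>, where W="\<lambda>t. ln (exp 1 / (1 - t)) powr (1 / q)" and M=M and D="2 powr (1 / q)" and B=32])
      show "continuous_on {0..<1} (\<lambda>t::real. ln (exp 1 / (1 - t)) powr (1 / q))"
      proof (intro continuous_intros ballI)
        fix t :: real assume "t \<in> {0..<1}"
        then show "ln (exp 1 / (1 - t)) \<noteq> 0" using ln_e_over_ge_1[of t] by auto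
      qed auto
      show "0 < ln (exp 1 / (1 - t)) powr (1 / q)" if "0 \<le> t" "t < 1" for t :: real
        using ln_e_over_ge_1[OF that] by simp
      show "ln (exp 1 / (1 - t)) powr (1 / q) \<le> ln (exp 1 / (1 - u)) powr (1 / q)"
        if "0 \<le> t" "t \<le> u" "u < 1" for t u :: real
      proof (rule powr_mono2)
        show "ln (exp 1 / (1 - t)) \<le> ln (exp 1 / (1 - u))"
          using that by (subst ln_le_cancel_iff) (auto intro!: divide_left_mono)
        show "0 \<le> ln (exp 1 / (1 - t))" using ln_e_over_ge_1[of t] that by linarith
      qed (use q in auto)
      show "ln (exp 1 / (1 - (1 + t) / 2)) powr (1 / q) \<le> 2 powr (1 / q) * ln (exp 1 / (1 - t)) powr (1 / q)"
        if "0 \<le> t" "t < 1" for t :: real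
      proof -
        have "exp 1 / (1 - (1 + t) / 2) = 2 * (exp 1 / (1 - t))" using that by (simp add: field_simps)
        then have "ln (exp 1 / (1 - (1 + t) / 2)) = ln 2 + ln (exp 1 / (1 - t))"
          using that by (simp only:) (subst ln_mult, auto)
        also have "\<dots> \<le> 2 * ln (exp 1 / (1 - t))"
          using ln_e_over_ge_1[OF that] ln_2_less_1 by linarith
        finally have le: "ln (exp 1 / (1 - (1 + t) / 2)) \<le> 2 * ln (exp 1 / (1 - t))" .
        have "ln (exp 1 / (1 - (1 + t) / 2)) powr (1 / q) \<le> (2 * ln (exp 1 / (1 - t))) powr (1 / q)"
        proof (intro powr_mono2 le)
          show "0 \<le> ln (exp 1 / (1 - (1 + t) / 2))"
            by (rule order_trans[OF zero_le_one ln_e_over_ge_1]) (use that in auto)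
        qed (use q in auto)
        also have "\<dots> = 2 powr (1 / q) * ln (exp 1 / (1 - t)) powr (1 / q)"
          by (rule powr_mult)
        finally show ?thesis .
      qed
      show "emeasure \<mu> {t..<1} * ennreal (ln (exp 1 / (1 - t)) powr (1 / q)) \<le> ennreal (M * (1 - t) powr (2 / p))"
        if "0 \<le> t" "t < 1" for t by (rule tail[OF that])
      show "(\<integral>\<^sup>+z. ennreal (norm (1 - of_real t * z) powr (- (q * (\<alpha> + 1)))) \<partial>disc_area)
          \<le> ennreal (32 * (ln (exp 1 / (1 - t)) powr (1 / q)) powr q)" if "0 \<le> t" "t < 1" for t
        using integral_kernel_critical[OF that] ln_e_over_ge_1[OF that] q
        by (simp add: c2 powr_powr)
    qed (use M in auto)
  qed
  show ?thesis
    unfolding exponent using a_suff a_nec b cc by (auto simp: \<delta>_def)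
qed

end
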